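(* Let $X>0$, $n\ge1$, let $a_0,a_1$ be $X$-periodic $\mathbb{C}^{n\times n}$-valued functions in $L^2_{\rm per}([0,X])$, and for $\sigma\in[0,2\pi)$ let $A_1(\sigma,x)=a_1(x)+2i\sigma I$, $A_0(\sigma,x)=a_0(x)-\sigma^2I+i\sigma a_1(x)$, $K(\sigma,\lambda)=\partial_x(\partial_x^2-1)^{-1}A_1(\sigma,\cdot)+(\partial_x^2-1)^{-1}(A_0(\sigma,\cdot)+(1-\lambda)I)$ on $L^2_{\rm per}([0,X];\mathbb{C}^n)$. Let $P_J$ be the orthogonal projection onto $\mathcal{H}_J=\operatorname{span}\{e^{2\pi ikx/X}v: |k|\le J, v\in\mathbb{C}^n\}$, and set $D_\sigma(\lambda)={\det}_2(I+K(\sigma,\lambda))$ and $D_{\sigma,J}(\lambda)={\det}_2(I+P_JK(\sigma,\lambda)P_J|_{\mathcal{H}_J})$. Then $D_{\sigma,J}(\lambda)\to D_\sigma(\lambda)$ as $J\to\infty$, uniformly in $\sigma\in[0,2\pi)$ and locally uniformly in $\lambda\in\mathbb{C}$.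
   Context: The multipliers act diagonally on Fourier modes $e^{2\pi ikx/X}$. The 2-modified Fredholm determinant: on finite-dimensional spaces ${\det}_2(I-A)=\det(I-A)e^{\operatorname{tr}A}$; for a Hilbert–Schmidt $A$ on a separable Hilbert space it is the limit of ${\det}_2$ of finite-dimensional compressions $P A P$ along any increasing sequence of finite-dimensional subspaces with dense union. ${\det}_2(I+K)$ means ${\det}_2(I-(-K))$. $K(\sigma,\lambda)$ is Hilbert–Schmidt. *)

theory Defs
  imports "HOL-Analysis.Analysis" "Jordan_Normal_Form.Determinant"
begin

definition L2_per :: "real \<Rightarrow> (real \<Rightarrow> complex) \<Rightarrow> bool" where
  "L2_per X f \<longleftrightarrow> (\<forall>x. f (x + X) = f x) \<and> f \<in> borel_measurable lebesgue
     \<and> (\<lambda>x. (cmod (f x))^2) integrable_on {0..X}"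

text \<open>Fourier coefficient with respect to the orthonormal basis X^(-1/2) e^(2 pi i k x / X):
  the matrix entry of multiplication by f is fourier_coeff X f (k - m).\<close>
definition fourier_coeff :: "real \<Rightarrow> (real \<Rightarrow> complex) \<Rightarrow> int \<Rightarrow> complex" where
  "fourier_coeff X f l =
     (1 / complex_of_real X) *
       integral {0..X} (\<lambda>x. f x * exp (- (2 * of_real pi * \<i> * of_int l * of_real x / of_real X)))"

section \<open>l2 over an index set (Fourier picture of L2_per([0,X];C^n))\<close>

definition l2_space :: "'i set \<Rightarrow> ('i \<Rightarrow> complex) set" where
  "l2_space S = {f. (\<forall>x. x \<notin> S \<longrightarrow> f x = 0) \<and> (\<lambda>x. (cmod (f x))^2) summable_on S}"

definition l2_inner :: "('i \<Rightarrow> complex) \<Rightarrow> ('i \<Rightarrow> complex) \<Rightarrow> complex" where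
  "l2_inner f g = (\<Sum>\<^sub>\<infinity>x. f x * cnj (g x))"

definition l2_norm :: "('i \<Rightarrow> complex) \<Rightarrow> real" where
  "l2_norm f = sqrt (\<Sum>\<^sub>\<infinity>x. (cmod (f x))^2)"

definition op_apply :: "('i \<Rightarrow> 'i \<Rightarrow> complex) \<Rightarrow> ('i \<Rightarrow> complex) \<Rightarrow> ('i \<Rightarrow> complex)" where
  "op_apply K f = (\<lambda>x. \<Sum>\<^sub>\<infinity>y. K x y * f y)"

definition hilbert_schmidt :: "'i set \<Rightarrow> ('i \<Rightarrow> 'i \<Rightarrow> complex) \<Rightarrow> bool" where
  "hilbert_schmidt S K \<longleftrightarrow> (\<forall>x y. (x, y) \<notin> S \<times> S \<longrightarrow> K x y = 0)
     \<and> (\<lambda>(x, y). (cmod (K x y))^2) summable_on (S \<times> S)"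

definition lspan :: "('i \<Rightarrow> complex) list \<Rightarrow> ('i \<Rightarrow> complex) set" where
  "lspan bs = {(\<lambda>x. \<Sum>i<length bs. c i * (bs ! i) x) | c. True}"

definition orthonormal_list :: "'i set \<Rightarrow> ('i \<Rightarrow> complex) list \<Rightarrow> bool" where
  "orthonormal_list S bs \<longleftrightarrow> set bs \<subseteq> l2_space S \<and>
     (\<forall>i<length bs. \<forall>j<length bs. l2_inner (bs ! i) (bs ! j) = (if i = j then 1 else 0))"

definition admissible_exhaustion :: "'i set \<Rightarrow> (nat \<Rightarrow> ('i \<Rightarrow> complex) list) \<Rightarrow> bool" where
  "admissible_exhaustion S bss \<longleftrightarrow> (\<forall>N. orthonormal_list S (bss N))
     \<and> (\<forall>N. lspan (bss N) \<subseteq> lspan (bss (Suc N)))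
     \<and> (\<forall>f\<in>l2_space S. \<forall>e>0. \<exists>N. \<exists>g\<in>lspan (bss N). l2_norm (\<lambda>x. f x - g x) < e)"

definition det2_fin :: "complex mat \<Rightarrow> complex" where
  "det2_fin M = det (1\<^sub>m (dim_row M) - M) * exp (\<Sum>i<dim_row M. M $$ (i, i))"

definition compression :: "('i \<Rightarrow> 'i \<Rightarrow> complex) \<Rightarrow> ('i \<Rightarrow> complex) list \<Rightarrow> complex mat" where
  "compression K bs = mat (length bs) (length bs) (\<lambda>(i, j). l2_inner (op_apply K (bs ! j)) (bs ! i))"

definition det2_I_minus :: "'i set \<Rightarrow> ('i \<Rightarrow> 'i \<Rightarrow> complex) \<Rightarrow> complex" where
  "det2_I_minus S K = (if hilbert_schmidt S K then
     (THE D. \<forall>bss. admissible_exhaustion S bss \<longrightarrow>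
        (\<lambda>N. det2_fin (compression K (bss N))) \<longlonglongrightarrow> D) else 0)"

text \<open>Index (k,i): Fourier mode k, vector component i < n.\<close>
definition idx_set :: "nat \<Rightarrow> (int \<times> nat) set" where
  "idx_set n = UNIV \<times> {..<n}"

definition freq :: "real \<Rightarrow> int \<Rightarrow> real" where
  "freq X k = 2 * pi * of_int k / X"

text \<open>Symbol of (d_x^2 - 1)^(-1) and of d_x (d_x^2 - 1)^(-1) on mode k.\<close>
definition res_symbol :: "real \<Rightarrow> int \<Rightarrow> complex" where
  "res_symbol X k = 1 / (- ((of_real (freq X k)) ^ 2) - 1)"

definition dres_symbol :: "real \<Rightarrow> int \<Rightarrow> complex" where
  "dres_symbol X k = \<i> * of_real (freq X k) / (- ((of_real (freq X k)) ^ 2) - 1)"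

definition mult_kernel :: "nat \<Rightarrow> real \<Rightarrow> (nat \<Rightarrow> nat \<Rightarrow> real \<Rightarrow> complex)
    \<Rightarrow> int \<times> nat \<Rightarrow> int \<times> nat \<Rightarrow> complex" where
  "mult_kernel n X A p q = (case p of (k, i) \<Rightarrow> case q of (m, j) \<Rightarrow>
     if i < n \<and> j < n then fourier_coeff X (A i j) (k - m) else 0)"

definition id_kernel :: "nat \<Rightarrow> int \<times> nat \<Rightarrow> int \<times> nat \<Rightarrow> complex" where
  "id_kernel n p q = (if p = q \<and> snd p < n then 1 else 0)"

definition A1 :: "(nat \<Rightarrow> nat \<Rightarrow> real \<Rightarrow> complex) \<Rightarrow> real \<Rightarrow> nat \<Rightarrow> nat \<Rightarrow> real \<Rightarrow> complex" where
  "A1 a1 \<sigma> i j x = a1 i j x + (if i = j then 2 * \<i> * of_real \<sigma> else 0)"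

definition A0 :: "(nat \<Rightarrow> nat \<Rightarrow> real \<Rightarrow> complex) \<Rightarrow> (nat \<Rightarrow> nat \<Rightarrow> real \<Rightarrow> complex)
    \<Rightarrow> real \<Rightarrow> nat \<Rightarrow> nat \<Rightarrow> real \<Rightarrow> complex" where
  "A0 a0 a1 \<sigma> i j x = a0 i j x - (if i = j then of_real (\<sigma>^2) else 0) + \<i> * of_real \<sigma> * a1 i j x"

definition K_kernel :: "nat \<Rightarrow> real \<Rightarrow> (nat \<Rightarrow> nat \<Rightarrow> real \<Rightarrow> complex) \<Rightarrow> (nat \<Rightarrow> nat \<Rightarrow> real \<Rightarrow> complex)
    \<Rightarrow> real \<Rightarrow> complex \<Rightarrow> int \<times> nat \<Rightarrow> int \<times> nat \<Rightarrow> complex" where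
  "K_kernel n X a0 a1 \<sigma> lam p q =
     dres_symbol X (fst p) * mult_kernel n X (A1 a1 \<sigma>) p q
     + res_symbol X (fst p) * (mult_kernel n X (A0 a0 a1 \<sigma>) p q + (1 - lam) * id_kernel n p q)"

definition D_sigma :: "nat \<Rightarrow> real \<Rightarrow> (nat \<Rightarrow> nat \<Rightarrow> real \<Rightarrow> complex) \<Rightarrow> (nat \<Rightarrow> nat \<Rightarrow> real \<Rightarrow> complex)
    \<Rightarrow> real \<Rightarrow> complex \<Rightarrow> complex" where
  "D_sigma n X a0 a1 \<sigma> lam = det2_I_minus (idx_set n) (\<lambda>p q. - K_kernel n X a0 a1 \<sigma> lam p q)"

text \<open>Orthonormal coordinate basis of H_J = span{e^(2 pi i k x/X) v : |k| \<le> J}.\<close>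
definition HJ_basis :: "nat \<Rightarrow> nat \<Rightarrow> (int \<times> nat \<Rightarrow> complex) list" where
  "HJ_basis n J = [(\<lambda>q. if q = (k, i) then 1 else 0). k \<leftarrow> [- int J..int J], i \<leftarrow> [0..<n]]"

definition D_sigma_J :: "nat \<Rightarrow> real \<Rightarrow> (nat \<Rightarrow> nat \<Rightarrow> real \<Rightarrow> complex) \<Rightarrow> (nat \<Rightarrow> nat \<Rightarrow> real \<Rightarrow> complex)
    \<Rightarrow> real \<Rightarrow> complex \<Rightarrow> nat \<Rightarrow> complex" where
  "D_sigma_J n X a0 a1 \<sigma> lam J =
     det2_fin (compression (\<lambda>p q. - K_kernel n X a0 a1 \<sigma> lam p q) (HJ_basis n J))"

end

theory Submission
  imports Defs "HOL-Complex_Analysis.Cauchy_Integral_Formula" "Jordan_Normal_Form.Schur_Decomposition"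
begin

text \<open>
  The eigenvalues of \<open>M\<^sup>* M\<close> give \<open>|det M|\<^sup>2 \<le> exp (\<parallel>M\<parallel>\<^sup>2 - N)\<close> in the Frobenius norm of an
  \<open>N \<times> N\<close> matrix, hence \<open>|det\<^sub>2 (I - A)| \<le> exp (\<parallel>A\<parallel>\<^sup>2 / 2)\<close>. Cauchy's estimate along complex
  lines turns this into a Lipschitz bound for \<open>det\<^sub>2\<close> whose constant depends on the
  Hilbert--Schmidt radius but not on the dimension.

  If the kernel \<open>K\<close> is cut down to a finite index set \<open>F\<close>, the compressions to any exhaustion
  converge to the determinant of the block \<open>K\<^sub>F\<close>, because Sylvester's identity transports
  everything to \<open>F\<close>. Together with the Lipschitz bound this shows that \<open>det\<^sub>2 (I - K)\<close> exists and
  lies within \<open>exp ((R + 1)\<^sup>2 / 2) \<parallel>K - K\<^sub>F\<parallel>\<close> of \<open>det\<^sub>2 (I - K\<^sub>F)\<close>, where \<open>R\<close> bounds \<open>\<parallel>K\<parallel>\<close>.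
  For the truncation to the modes \<open>|k| \<le> J\<close>, both \<open>R\<close> and the tail \<open>\<parallel>K - K\<^sub>F\<parallel>\<close> are controlled
  uniformly in \<open>\<sigma>\<close> and in bounded \<open>\<lambda>\<close> by one summable weight
  \<open>(1 + freq\<^sup>2)\<^sup>-\<^sup>1 H (k - m)\<close>, whose summability is Bessel's inequality for the Fourier coefficients.
\<close>

section \<open>The regularized determinant of a matrix\<close>

text \<open>Frobenius norm, phrased through \<open>L2_set\<close> over index pairs so that
  Minkowski's inequality \<open>L2_set_triangle_ineq\<close> applies to matrices directly.\<close>

definition frob :: "complex mat \<Rightarrow> real" where
  "frob M = L2_set (\<lambda>p. cmod (M $$ p)) ({..<dim_row M} \<times> {..<dim_col M})"

lemma frob_squared:
  "(frob M)\<^sup>2 = (\<Sum>i<dim_row M. \<Sum>j<dim_col M. (cmod (M $$ (i, j)))\<^sup>2)"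
  by (simp add: frob_def L2_set_def sum_nonneg sum.cartesian_product case_prod_unfold)

section \<open>Trace, eigenvalues of the adjoint product, and the determinant bound\<close>

lemma trace_mult_commute:
  fixes A B :: "'a :: comm_ring_1 mat"
  assumes "A \<in> carrier_mat n m" "B \<in> carrier_mat m n"
  shows "(\<Sum>i<n. (A * B) $$ (i, i)) = (\<Sum>i<m. (B * A) $$ (i, i))"
proof -
  have "(\<Sum>i<n. (A * B) $$ (i, i)) = (\<Sum>i<n. \<Sum>j<m. A $$ (i, j) * B $$ (j, i))"
    using assms by (intro sum.cong refl) (auto simp: scalar_prod_def lessThan_atLeast0)
  also have "\<dots> = (\<Sum>j<m. \<Sum>i<n. B $$ (j, i) * A $$ (i, j))"
    by (subst sum.swap) (simp add: mult.commute)
  also have "\<dots> = (\<Sum>i<m. (B * A) $$ (i, i))"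
    using assms by (intro sum.cong refl) (auto simp: scalar_prod_def lessThan_atLeast0)
  finally show ?thesis .
qed

lemma trace_similar:
  fixes A B :: "'a :: comm_ring_1 mat"
  assumes "similar_mat_wit A B P Q" "A \<in> carrier_mat n n"
  shows "(\<Sum>i<n. A $$ (i, i)) = (\<Sum>i<n. B $$ (i, i))"
proof -
  have c: "B \<in> carrier_mat n n" "P \<in> carrier_mat n n" "Q \<in> carrier_mat n n"
    "Q * P = 1\<^sub>m n" "A = P * B * Q"
    using assms unfolding similar_mat_wit_def Let_def by auto
  have "Q * (P * B) = B"
    using c by (metis assoc_mult_mat left_mult_one_mat)
  then show ?thesis
    using trace_mult_commute[of "P * B" n n Q] c by auto
qed

text \<open>Pairing the eigenvalue equation with \<open>v\<close> gives
  \<open>e * s = |M v|^2\<close> with \<open>s = |v|^2 > 0\<close>; the entries of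
  \<open>M v\<close> are the \<open>w k\<close>.\<close>

lemma eigenvalue_adjoint_mult_self_nonneg:
  fixes M :: "complex mat"
  assumes M: "M \<in> carrier_mat n n"
    and ev: "eigenvalue (map_mat cnj (transpose_mat M) * M) e"
  shows "\<exists>r\<ge>0. e = complex_of_real r"
proof -
  let ?H = "map_mat cnj (transpose_mat M) * M"
  obtain v where v: "v \<in> carrier_vec n" "v \<noteq> 0\<^sub>v n" "?H *\<^sub>v v = e \<cdot>\<^sub>v v"
    using ev M unfolding eigenvalue_def eigenvector_def by auto
  define s where "s = (\<Sum>i<n. (cmod (v $ i))\<^sup>2)"
  define w where "w k = (\<Sum>j<n. M $$ (k, j) * v $ j)" for k
  obtain i where "i < n" "v $ i \<noteq> 0"
    using v(1,2) by (metis eq_vecI carrier_vecD index_zero_vec(1) index_zero_vec(2))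
  then have s: "s > 0"
    unfolding s_def by (intro sum_pos2[of _ i]) auto
  have Hv: "(\<Sum>k<n. cnj (M $$ (k, i)) * w k) = e * v $ i" if "i < n" for i
  proof -
    have "e * v $ i = (?H *\<^sub>v v) $ i"
      using v that by simp
    also have "\<dots> = (map_mat cnj (transpose_mat M) *\<^sub>v (M *\<^sub>v v)) $ i"
      using M v(1) by (subst assoc_mult_mat_vec[of _ n n _ n]) auto
    also have "\<dots> = (\<Sum>k<n. cnj (M $$ (k, i)) * w k)"
      using M v(1) that by (auto simp: scalar_prod_def lessThan_atLeast0 w_def)
    finally show ?thesis by simp
  qed
  have "e * of_real s = (\<Sum>i<n. cnj (v $ i) * (e * v $ i))"
    unfolding s_def of_real_sum complex_norm_square by (simp add: sum_distrib_left mult_ac)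
  also have "\<dots> = (\<Sum>i<n. cnj (v $ i) * (\<Sum>k<n. cnj (M $$ (k, i)) * w k))"
    by (intro sum.cong refl) (simp add: Hv)
  also have "\<dots> = (\<Sum>k<n. w k * cnj (w k))"
    unfolding sum_distrib_left by (subst sum.swap) (simp add: w_def sum_distrib_left mult_ac)
  also have "\<dots> = of_real (\<Sum>k<n. (cmod (w k))\<^sup>2)"
    by (simp only: of_real_sum complex_norm_square)
  finally have "e = of_real ((\<Sum>k<n. (cmod (w k))\<^sup>2) / s)"
    using s by (simp add: field_simps)
  moreover have "(\<Sum>k<n. (cmod (w k))\<^sup>2) / s \<ge> 0"
    using s by (intro divide_nonneg_pos sum_nonneg) auto
  ultimately show ?thesis by blast
qed

text \<open>The diagonal of a Schur form of \<open>?H\<close> lists its eigenvalues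
  \<open>r i\<close>. Their product is \<open>|det M|^2\<close> and their sum is the trace of
  \<open>?H\<close>, that is \<open>(frob M)\<^sup>2\<close>. Each factor satisfies
  \<open>r \<le> exp (r - 1)\<close>, so the bound is sharp at the identity matrix.\<close>

lemma cmod_det_squared_le_exp:
  fixes M :: "complex mat"
  assumes M: "M \<in> carrier_mat n n"
  shows "(cmod (det M))\<^sup>2 \<le> exp ((frob M)\<^sup>2 - real n)"
proof -
  interpret cnj_hom: comm_ring_hom cnj
    by unfold_locales auto
  let ?H = "map_mat cnj (transpose_mat M) * M"
  have H: "?H \<in> carrier_mat n n" using M by auto
  obtain es where es: "char_poly ?H = (\<Prod>a\<leftarrow>es. [:- a, 1:])" "length es = n"
    using char_poly_factorized[OF H] by blast
  obtain B P Q where B: "similar_mat_wit ?H B P Q" "upper_triangular B" "diag_mat B = es"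
    using schur_decomposition[OF H es(1)] by (metis prod_cases3)
  have Bc: "B \<in> carrier_mat n n"
    using B(1) H unfolding similar_mat_wit_def Let_def by auto
  have "\<exists>r. \<forall>i<n. r i \<ge> 0 \<and> es ! i = complex_of_real (r i)"
  proof (rule ccontr)
    have *: "\<exists>r\<ge>0. es ! i = complex_of_real r" if "i < n" for i
    proof (rule eigenvalue_adjoint_mult_self_nonneg[OF M])
      have "poly (char_poly ?H) (es ! i) = 0"
        unfolding es(1) poly_prod_list using that es(2)
        by (force simp: prod_list_zero_iff in_set_conv_nth)
      then show "eigenvalue ?H (es ! i)"
        using eigenvalue_root_char_poly[OF H] by simp
    qed
    assume "\<nexists>r. \<forall>i<n. r i \<ge> 0 \<and> es ! i = complex_of_real (r i)"
    then show False using * by metis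
  qed
  then obtain r where r: "\<And>i. i < n \<Longrightarrow> r i \<ge> 0" "\<And>i. i < n \<Longrightarrow> es ! i = complex_of_real (r i)"
    by blast
  have "of_real ((cmod (det M))\<^sup>2) = det ?H"
    using M by (simp add: det_mult[of _ n] det_transpose mult.commute del: of_real_power
      flip: complex_norm_square)
  also have "\<dots> = prod_list es"
    using det_similar[of ?H B] det_upper_triangular[OF B(2) Bc] B similar_mat_def by metis
  also have "\<dots> = of_real (\<Prod>i<n. r i)"
    by (simp add: prod.list_conv_set_nth es(2) lessThan_atLeast0 r(2))
  finally have det: "(cmod (det M))\<^sup>2 = (\<Prod>i<n. r i)"
    using of_real_eq_iff by blast
  have "complex_of_real (\<Sum>i<n. r i) = (\<Sum>i<n. B $$ (i, i))"
    using B(3) Bc r(2) by (auto simp: diag_mat_def)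
  also have "\<dots> = (\<Sum>i<n. ?H $$ (i, i))"
    using trace_similar[OF B(1) H] by simp
  also have "\<dots> = (\<Sum>i<n. \<Sum>k<n. of_real ((cmod (M $$ (k, i)))\<^sup>2))"
    using M unfolding complex_norm_square
    by (intro sum.cong refl) (auto simp: scalar_prod_def lessThan_atLeast0 mult.commute)
  also have "\<dots> = of_real ((frob M)\<^sup>2)"
    using M unfolding frob_squared by (subst sum.swap) simp
  finally have tr: "(frob M)\<^sup>2 = (\<Sum>i<n. r i)"
    using of_real_eq_iff by metis
  have "(\<Prod>i<n. r i) \<le> (\<Prod>i<n. exp (r i - 1))"
    by (intro prod_mono) (use r(1) exp_ge_add_one_self[of "r i - 1" for i] in auto)
  also have "\<dots> = exp ((frob M)\<^sup>2 - real n)"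
    by (simp add: exp_sum[symmetric] sum_subtractf tr)
  finally show ?thesis using det by simp
qed

text \<open>Since \<open>(frob (I - A))\<^sup>2 = (frob A)\<^sup>2 + n - 2 Re tr A\<close>, the
  determinant bound loses the dimension, and the trace cancels against
  \<open>|exp (tr A)|^2 = exp (2 Re tr A)\<close>. This cancellation is the purpose of the
  regularizing factor.\<close>

lemma cmod_det2_fin_le:
  assumes A: "A \<in> carrier_mat n n"
  shows "cmod (det2_fin A) \<le> exp ((frob A)\<^sup>2 / 2)"
proof -
  let ?t = "\<Sum>i<n. A $$ (i, i)"
  have c: "1\<^sub>m n - A \<in> carrier_mat n n" using A by auto
  have entry: "(cmod ((if i = j then 1 else 0) - A $$ (i, j)))\<^sup>2
      = (cmod (A $$ (i, j)))\<^sup>2 + (if i = j then 1 - 2 * Re (A $$ (i, i)) else 0)" for i j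
    by (cases "i = j") (simp_all add: cmod_power2, simp add: power2_eq_square algebra_simps)
  have "(frob (1\<^sub>m n - A))\<^sup>2 = (\<Sum>i<n. \<Sum>j<n. (cmod ((if i = j then 1 else 0) - A $$ (i, j)))\<^sup>2)"
    using A unfolding frob_squared by (intro sum.cong) auto
  also have "\<dots> = (frob A)\<^sup>2 + (\<Sum>i<n. 1 - 2 * Re (A $$ (i, i)))"
    using A unfolding entry frob_squared by (simp add: sum.distrib)
  also have "\<dots> = (frob A)\<^sup>2 + real n - 2 * Re ?t"
    by (simp add: sum_subtractf sum_distrib_left)
  finally have f: "(frob (1\<^sub>m n - A))\<^sup>2 - real n = (frob A)\<^sup>2 - 2 * Re ?t" by simp
  have "(cmod (det2_fin A))\<^sup>2 = (cmod (det (1\<^sub>m n - A)))\<^sup>2 * exp (2 * Re ?t)"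
    using A by (simp add: det2_fin_def norm_mult power_mult_distrib exp_double)
  also have "\<dots> \<le> exp ((frob A)\<^sup>2 - 2 * Re ?t) * exp (2 * Re ?t)"
    using cmod_det_squared_le_exp[OF c] f by (intro mult_right_mono) auto
  also have "\<dots> = (exp ((frob A)\<^sup>2 / 2))\<^sup>2"
    by (simp flip: exp_add exp_double)
  finally show ?thesis
    by (rule power2_le_imp_le) simp
qed

section \<open>Sylvester's identity, continuity and the Lipschitz bound\<close>

text \<open>The block matrix \<open>?N\<close> is multiplied by the unimodular \<open>?L\<close> on
  either side. Both products have a zero lower left block; from the left the remaining diagonal
  block is \<open>1 - B * A\<close>, from the right it is \<open>1 - A * B\<close>.\<close>

lemma det_one_minus_mult_commute:
  fixes A B :: "complex mat"
  assumes A: "A \<in> carrier_mat n m" and B: "B \<in> carrier_mat m n"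
  shows "det (1\<^sub>m n - A * B) = det (1\<^sub>m m - B * A)"
proof -
  let ?N = "four_block_mat (1\<^sub>m n) A B (1\<^sub>m m)"
  let ?L = "four_block_mat (1\<^sub>m n) (0\<^sub>m n m) (- B) (1\<^sub>m m)"
  have N: "?N \<in> carrier_mat (n + m) (n + m)" and L: "?L \<in> carrier_mat (n + m) (n + m)"
    using A B by auto
  have c: "1\<^sub>m m - B * A \<in> carrier_mat m m" "1\<^sub>m n - A * B \<in> carrier_mat n n"
    using A B by auto
  have dL: "det ?L = 1"
    using det_four_block_mat_upper_right_zero[of "1\<^sub>m n" n "0\<^sub>m n m" m "- B" "1\<^sub>m m"] B by simp
  have "?L * ?N = four_block_mat (1\<^sub>m n) A (0\<^sub>m m n) (1\<^sub>m m - B * A)"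
    using A B by (subst mult_four_block_mat[of _ n n _ m _ m _ _ n _ m]) 
      (auto intro!: cong_four_block_mat eq_matI)
  then have "det ?L * det ?N = det (1\<^sub>m m - B * A)"
    using det_mult[OF L N] det_four_block_mat_lower_left_zero[of "1\<^sub>m n" n A m "0\<^sub>m m n" "1\<^sub>m m - B * A"] A B c
    by simp
  moreover have "?N * ?L = four_block_mat (1\<^sub>m n - A * B) A (0\<^sub>m m n) (1\<^sub>m m)"
    using A B by (subst mult_four_block_mat[of _ n n _ m _ m _ _ n _ m]) 
      (auto intro!: cong_four_block_mat eq_matI)
  then have "det ?N * det ?L = det (1\<^sub>m n - A * B)"
    using det_mult[OF N L] det_four_block_mat_lower_left_zero[of "1\<^sub>m n - A * B" n A m "0\<^sub>m m n" "1\<^sub>m m"] A B c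
    by simp
  ultimately show ?thesis using dL by simp
qed

lemma det2_fin_mult_commute:
  assumes "A \<in> carrier_mat n m" "B \<in> carrier_mat m n"
  shows "det2_fin (A * B) = det2_fin (B * A)"
  using assms det_one_minus_mult_commute[OF assms] trace_mult_commute[OF assms]
  by (simp add: det2_fin_def)

text \<open>In a fixed dimension the Leibniz formula makes \<open>det2_fin\<close> a continuous
  function of the entries.\<close>

lemma tendsto_det2_fin:
  assumes "\<And>N. A N \<in> carrier_mat m m" "B \<in> carrier_mat m m"
    and "\<And>i j. i < m \<Longrightarrow> j < m \<Longrightarrow> ((\<lambda>N. A N $$ (i, j)) \<longlongrightarrow> B $$ (i, j)) F"
  shows "((\<lambda>N. det2_fin (A N)) \<longlongrightarrow> det2_fin B) F"
proof -
  have c: "1\<^sub>m m - A N \<in> carrier_mat m m" "1\<^sub>m m - B \<in> carrier_mat m m"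
    "dim_row (A N) = m" "dim_col (A N) = m" "dim_row B = m" "dim_col B = m" for N
    using assms(1)[of N] assms(2) by auto
  have "((\<lambda>N. det (1\<^sub>m m - A N)) \<longlongrightarrow> det (1\<^sub>m m - B)) F"
    unfolding det_def'[OF c(1)] det_def'[OF c(2)]
  proof (intro tendsto_sum tendsto_mult tendsto_const tendsto_prod)
    fix p i assume "p \<in> {p. p permutes {0..<m}}" "i \<in> {0..<m}"
    then have "p i < m" "i < m"
      using permutes_in_image[of p "{0..<m}" i] by auto
    then show "((\<lambda>N. (1\<^sub>m m - A N) $$ (i, p i)) \<longlongrightarrow> (1\<^sub>m m - B) $$ (i, p i)) F"
      using c by (auto intro!: tendsto_intros assms(3))
  qed
  then show ?thesis
    unfolding det2_fin_def c by (intro tendsto_intros assms(3)) auto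
qed

text \<open>Cauchy's estimate along the complex line through \<open>A\<close> and \<open>B\<close>, on circles of radius
  \<open>1 / d\<close>, turns the bound for \<open>det2_fin\<close> into a Lipschitz bound that does not depend on the
  dimension.\<close>

lemma det2_fin_lipschitz:
  assumes A: "A \<in> carrier_mat n n" and B: "B \<in> carrier_mat n n"
    and R: "frob A \<le> R" "frob B \<le> R" and d: "frob (B - A) \<le> d" "d > 0"
  shows "cmod (det2_fin A - det2_fin B) \<le> exp ((R + 1)\<^sup>2 / 2) * d"
proof -
  define I where "I = {..<n} \<times> {..<n}"
  define C where "C z = mat n n (\<lambda>p. A $$ p + z * (B $$ p - A $$ p))" for z
  define g where "g z = det2_fin (C z)" for z
  let ?K = "exp ((R + 1)\<^sup>2 / 2)"
  have C: "C z \<in> carrier_mat n n" for z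
    by (simp add: C_def)
  \<comment> \<open>The entries of \<open>C z\<close> are affine in \<open>z\<close>, so the Leibniz
    formula exhibits the determinant as a polynomial in \<open>z\<close>.\<close>
  have hol: "g holomorphic_on UNIV"
  proof -
    have c: "1\<^sub>m n - C z \<in> carrier_mat n n" "dim_row (C z) = n" for z
      using C[of z] by auto
    show ?thesis
      unfolding g_def det2_fin_def c(2) det_def'[OF c(1)]
    proof (intro holomorphic_intros)
      fix p i assume "p \<in> {p. p permutes {0..<n}}" "i \<in> {0..<n}"
      then have "p i < n" "i < n"
        using permutes_in_image[of p "{0..<n}" i] by auto
      then show "(\<lambda>z. (1\<^sub>m n - C z) $$ (i, p i)) holomorphic_on UNIV"
        by (auto simp: C_def intro!: holomorphic_intros)
    next
      fix i assume "i \<in> {..<n}"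
      then show "(\<lambda>z. C z $$ (i, i)) holomorphic_on UNIV"
        by (simp add: C_def) (intro holomorphic_intros)
    qed
  qed
  \<comment> \<open>\<open>C (t + u)\<close> is the convex combination
    \<open>(1 - t) A + t B\<close> plus \<open>u (B - A)\<close>. The first part has norm at most
    \<open>R\<close> and the second at most \<open>d / d = 1\<close>, whence the radius
    \<open>R + 1\<close>.\<close>
  have bound: "cmod (g (of_real t + u)) \<le> ?K"
    if t: "0 \<le> t" "t \<le> 1" and u: "cmod u = 1 / d" for t u
  proof -
    have fA: "L2_set (\<lambda>p. cmod (A $$ p)) I \<le> R" and fB: "L2_set (\<lambda>p. cmod (B $$ p)) I \<le> R"
      using A B R by (auto simp: frob_def I_def)
    have fD: "L2_set (\<lambda>p. cmod (B $$ p - A $$ p)) I \<le> d"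
    proof -
      have "L2_set (\<lambda>p. cmod (B $$ p - A $$ p)) I = frob (B - A)"
        using A B unfolding frob_def I_def by (intro L2_set_cong) auto
      then show ?thesis using d(1) by simp
    qed
    have "frob (C (of_real t + u)) = L2_set (\<lambda>p. cmod (C (of_real t + u) $$ p)) I"
      by (simp add: frob_def C_def I_def)
    also have "\<dots> \<le> L2_set (\<lambda>p. ((1 - t) * cmod (A $$ p) + t * cmod (B $$ p))
        + 1 / d * cmod (B $$ p - A $$ p)) I"
    proof (rule L2_set_mono)
      fix p assume "p \<in> I"
      then have "C (of_real t + u) $$ p
          = of_real (1 - t) * A $$ p + of_real t * B $$ p + u * (B $$ p - A $$ p)"
        by (auto simp: C_def I_def algebra_simps)
      also have "cmod \<dots> \<le> cmod (of_real (1 - t) * A $$ p) + cmod (of_real t * B $$ p)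
          + cmod (u * (B $$ p - A $$ p))"
        by (intro norm_triangle_mono norm_triangle_ineq order_refl)
      also have "\<dots> = (1 - t) * cmod (A $$ p) + t * cmod (B $$ p) + 1 / d * cmod (B $$ p - A $$ p)"
        using t u by (simp only: norm_mult norm_of_real)
      finally show "cmod (C (of_real t + u) $$ p) \<le> \<dots>" .
    qed simp
    also have "\<dots> \<le> L2_set (\<lambda>p. (1 - t) * cmod (A $$ p) + t * cmod (B $$ p)) I
        + L2_set (\<lambda>p. 1 / d * cmod (B $$ p - A $$ p)) I"
      by (rule L2_set_triangle_ineq)
    also have "\<dots> \<le> L2_set (\<lambda>p. (1 - t) * cmod (A $$ p)) I + L2_set (\<lambda>p. t * cmod (B $$ p)) I
        + L2_set (\<lambda>p. 1 / d * cmod (B $$ p - A $$ p)) I"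
      by (intro add_right_mono L2_set_triangle_ineq)
    also have "\<dots> = (1 - t) * L2_set (\<lambda>p. cmod (A $$ p)) I + t * L2_set (\<lambda>p. cmod (B $$ p)) I
        + 1 / d * L2_set (\<lambda>p. cmod (B $$ p - A $$ p)) I"
      using t d(2) by (subst (1 2 3) L2_set_right_distrib) auto
    also have "\<dots> \<le> (1 - t) * R + t * R + 1 / d * d"
      using t d(2) fA fB fD by (intro add_mono mult_left_mono) auto
    also have "\<dots> = R + 1"
      using d(2) by (simp add: algebra_simps)
    finally have "(frob (C (of_real t + u)))\<^sup>2 \<le> (R + 1)\<^sup>2"
      by (intro power_mono) (simp_all add: frob_def L2_set_nonneg)
    then show ?thesis
      unfolding g_def using cmod_det2_fin_le[OF C, of "of_real t + u"]
      by (smt (verit) exp_le_cancel_iff divide_right_mono)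
  qed
  \<comment> \<open>Cauchy's estimate on a circle of radius \<open>1 / d\<close> bounds the
    derivative by \<open>?K / (1 / d)\<close>; the segment from \<open>A\<close> at \<open>0\<close>
    to \<open>B\<close> at \<open>1\<close> has length one.\<close>
  have der: "cmod (deriv g z) \<le> ?K * d" if "z \<in> closed_segment 0 1" for z
  proof -
    obtain t where t: "z = of_real t" "0 \<le> t" "t \<le> 1"
      using \<open>z \<in> closed_segment 0 1\<close> by (auto simp: in_segment scaleR_conv_of_real)
    have "cmod ((deriv ^^ 1) g z) \<le> fact 1 * ?K / (1 / d) ^ 1"
    proof (rule Cauchy_inequality)
      show "g holomorphic_on ball z (1 / d)" "continuous_on (cball z (1 / d)) g"
        using hol by (auto intro: holomorphic_on_subset holomorphic_on_imp_continuous_on)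
      fix x assume "cmod (z - x) = 1 / d"
      then show "cmod (g x) \<le> ?K"
        using bound[of t "x - z"] t by (simp add: norm_minus_commute)
    qed (use d in auto)
    then show ?thesis by simp
  qed
  have "cmod (g 0 - g 1) \<le> ?K * d * cmod (0 - 1)"
  proof (rule field_differentiable_bound[of "closed_segment 0 1" g "deriv g"])
    fix z assume "z \<in> closed_segment 0 (1::complex)"
    show "(g has_field_derivative deriv g z) (at z within closed_segment 0 1)"
      using holomorphic_derivI[OF hol open_UNIV] by (auto intro: has_field_derivative_at_within)
  qed (use der in auto)
  moreover have "C 0 = A" "C 1 = B"
    using A B by (auto simp: C_def)
  ultimately show ?thesis
    by (simp add: g_def)
qed

section \<open>Square-summable kernels\<close>

lemma mult_le_sum_squares: "a * b \<le> a\<^sup>2 + b\<^sup>2" for a b :: real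
  using zero_le_power2[of "a - b"] zero_le_power2[of a] zero_le_power2[of b]
  unfolding power2_diff by linarith

section \<open>Bessel's inequality over a general measure\<close>

lemma sq_integrable_mult_cnj:
  fixes f g :: "'a \<Rightarrow> complex"
  assumes "f \<in> borel_measurable M" "g \<in> borel_measurable M"
    and "integrable M (\<lambda>x. (cmod (f x))\<^sup>2)" "integrable M (\<lambda>x. (cmod (g x))\<^sup>2)"
  shows "integrable M (\<lambda>x. f x * cnj (g x))"
proof (rule Bochner_Integration.integrable_bound)
  show "integrable M (\<lambda>x. (cmod (f x))\<^sup>2 + (cmod (g x))\<^sup>2)"
    using assms by simp
  show "AE x in M. norm (f x * cnj (g x)) \<le> norm ((cmod (f x))\<^sup>2 + (cmod (g x))\<^sup>2)"
    by (simp add: norm_mult mult_le_sum_squares)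
  have "cnj \<in> borel_measurable borel"
    by (intro borel_measurable_continuous_onI continuous_intros)
  then show "(\<lambda>x. f x * cnj (g x)) \<in> borel_measurable M"
    using assms(1) measurable_compose[OF assms(2)] by (intro borel_measurable_times) auto
qed

text \<open>The residual \<open>h\<close> of \<open>f\<close> after subtracting its components has
  squared norm \<open>|f|^2 - \<Sum> |c i|^2\<close>, which is nonnegative. A general measure is
  taken so that the result serves both counting measure on indices and Lebesgue measure on a
  period.\<close>

lemma bessel_inequality:
  fixes f :: "'a \<Rightarrow> complex" and b :: "'b \<Rightarrow> 'a \<Rightarrow> complex"
  assumes I: "finite I"
    and f: "f \<in> borel_measurable M" "integrable M (\<lambda>x. (cmod (f x))\<^sup>2)"
    and b: "\<And>i. i \<in> I \<Longrightarrow> b i \<in> borel_measurable M"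
      "\<And>i. i \<in> I \<Longrightarrow> integrable M (\<lambda>x. (cmod (b i x))\<^sup>2)"
    and on: "\<And>i j. i \<in> I \<Longrightarrow> j \<in> I \<Longrightarrow>
      (LINT x|M. b i x * cnj (b j x)) = (if i = j then 1 else 0)"
  shows "(\<Sum>i\<in>I. (cmod (LINT x|M. f x * cnj (b i x)))\<^sup>2) \<le> (LINT x|M. (cmod (f x))\<^sup>2)"
proof -
  define c where "c i = (LINT x|M. f x * cnj (b i x))" for i
  define h where "h x = f x - (\<Sum>i\<in>I. c i * b i x)" for x
  have int: "integrable M (\<lambda>x. f x * cnj (f x))"
    "\<And>i. i \<in> I \<Longrightarrow> integrable M (\<lambda>x. f x * cnj (b i x))"
    "\<And>i. i \<in> I \<Longrightarrow> integrable M (\<lambda>x. b i x * cnj (f x))"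
    "\<And>i j. i \<in> I \<Longrightarrow> j \<in> I \<Longrightarrow> integrable M (\<lambda>x. b i x * cnj (b j x))"
    using f b by (auto intro!: sq_integrable_mult_cnj)
  have bf: "(LINT x|M. b i x * cnj (f x)) = cnj (c i)" for i
    unfolding c_def by (subst Bochner_Integration.integral_cnj[symmetric]) (simp add: mult.commute)
  have expand: "of_real ((cmod (h x))\<^sup>2) =
      f x * cnj (f x) - (\<Sum>i\<in>I. cnj (c i) * (f x * cnj (b i x)))
      - (\<Sum>i\<in>I. c i * (b i x * cnj (f x)))
      + (\<Sum>i\<in>I. \<Sum>j\<in>I. c i * cnj (c j) * (b i x * cnj (b j x)))" for x
    unfolding complex_norm_square h_def
    by (simp add: algebra_simps sum_product sum_distrib_left sum_distrib_right) (rule sum.swap)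
  have "complex_of_real (LINT x|M. (cmod (h x))\<^sup>2) = (LINT x|M. of_real ((cmod (h x))\<^sup>2))"
    by (rule integral_complex_of_real[symmetric])
  also have "\<dots> = (LINT x|M. f x * cnj (f x)) - (\<Sum>i\<in>I. cnj (c i) * c i)
      - (\<Sum>i\<in>I. c i * cnj (c i)) + (\<Sum>i\<in>I. \<Sum>j\<in>I. c i * cnj (c j) * (if i = j then 1 else 0))"
    unfolding expand using I int
    by (simp add: Bochner_Integration.integral_sum c_def[symmetric] bf on)
  also have "(\<Sum>i\<in>I. \<Sum>j\<in>I. c i * cnj (c j) * (if i = j then 1 else 0)) = (\<Sum>i\<in>I. c i * cnj (c i))"
    using I by (intro sum.cong refl) (simp add: if_distrib cong: if_cong)
  also have "(LINT x|M. f x * cnj (f x)) = of_real (LINT x|M. (cmod (f x))\<^sup>2)"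
    unfolding complex_norm_square[symmetric] by (rule integral_complex_of_real)
  finally have "complex_of_real (LINT x|M. (cmod (h x))\<^sup>2)
      = of_real ((LINT x|M. (cmod (f x))\<^sup>2) - (\<Sum>i\<in>I. (cmod (c i))\<^sup>2))"
    by (simp add: complex_norm_square mult.commute del: of_real_power)
  then have "(LINT x|M. (cmod (h x))\<^sup>2) = (LINT x|M. (cmod (f x))\<^sup>2) - (\<Sum>i\<in>I. (cmod (c i))\<^sup>2)"
    using of_real_eq_iff by blast
  moreover have "(LINT x|M. (cmod (h x))\<^sup>2) \<ge> 0"
    by simp
  ultimately show ?thesis
    unfolding c_def by linarith
qed

section \<open>Square-summable functions on an index type\<close>

definition sq_summable :: "('a \<Rightarrow> complex) \<Rightarrow> bool" where
  "sq_summable f \<longleftrightarrow> (\<lambda>x. (cmod (f x))\<^sup>2) summable_on UNIV"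

text \<open>Rewrites sums over the index type as integrals against counting measure, so that the
  integral form of Bessel's inequality can be reused.\<close>

lemma integral_count_space_eq_infsum:
  fixes f :: "'a \<Rightarrow> 'b::{banach, second_countable_topology}"
  assumes "(\<lambda>x. norm (f x)) summable_on UNIV"
  shows "integrable (count_space UNIV) f" "integral\<^sup>L (count_space UNIV) f = infsum f UNIV"
proof -
  have *: "Infinite_Set_Sum.abs_summable_on f UNIV"
    using assms abs_summable_equivalent by blast
  show "integrable (count_space UNIV) f"
    using * by (simp add: Infinite_Set_Sum.abs_summable_on_def)
  show "integral\<^sup>L (count_space UNIV) f = infsum f UNIV"
    using infsetsum_infsum[OF *] by (simp add: infsetsum_def)
qed

lemma sq_summable_mult_norm:
  assumes "sq_summable f" "sq_summable g"
  shows "(\<lambda>x. norm (f x * g x)) summable_on UNIV"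
proof (rule summable_on_comparison_test)
  show "(\<lambda>x. (cmod (f x))\<^sup>2 + (cmod (g x))\<^sup>2) summable_on UNIV"
    using assms unfolding sq_summable_def by (rule summable_on_add)
  show "norm (f x * g x) \<le> (cmod (f x))\<^sup>2 + (cmod (g x))\<^sup>2" for x
    by (simp add: norm_mult mult_le_sum_squares)
qed auto

lemma sq_summable_cnj [simp]: "sq_summable (\<lambda>x. cnj (f x)) \<longleftrightarrow> sq_summable f"
  by (simp add: sq_summable_def)

lemma sq_summable_mult_cnj:
  assumes "sq_summable f" "sq_summable g"
  shows "(\<lambda>x. f x * cnj (g x)) summable_on UNIV"
  using sq_summable_mult_norm[of f "\<lambda>x. cnj (g x)"] assms abs_summable_summable by auto

lemma sq_summable_cmult: "sq_summable f \<Longrightarrow> sq_summable (\<lambda>x. c * f x)"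
  unfolding sq_summable_def norm_mult power_mult_distrib by (rule summable_on_cmult_right)

lemma sq_summable_add:
  assumes "sq_summable f" "sq_summable g"
  shows "sq_summable (\<lambda>x. f x + g x)"
  unfolding sq_summable_def
proof (rule summable_on_comparison_test)
  show "(\<lambda>x. 2 * (cmod (f x))\<^sup>2 + 2 * (cmod (g x))\<^sup>2) summable_on UNIV"
    using assms unfolding sq_summable_def by (intro summable_on_add summable_on_cmult_right)
  fix x
  have "(cmod (f x + g x))\<^sup>2 \<le> (cmod (f x) + cmod (g x))\<^sup>2"
    by (intro power_mono norm_triangle_ineq) auto
  also have "\<dots> \<le> 2 * (cmod (f x))\<^sup>2 + 2 * (cmod (g x))\<^sup>2"
    using sum_squares_bound[of "cmod (f x)" "cmod (g x)"] by (simp add: power2_sum)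
  finally show "(cmod (f x + g x))\<^sup>2 \<le> 2 * (cmod (f x))\<^sup>2 + 2 * (cmod (g x))\<^sup>2" .
qed auto

lemma sq_summable_diff:
  "sq_summable f \<Longrightarrow> sq_summable g \<Longrightarrow> sq_summable (\<lambda>x. f x - g x)"
  using sq_summable_add[of f "\<lambda>x. - 1 * g x"] sq_summable_cmult[of g "- 1"] by simp

lemma sq_summable_zero [simp]: "sq_summable (\<lambda>x. 0)"
  by (simp add: sq_summable_def)

lemma sq_summable_sum:
  "(\<And>i. i \<in> I \<Longrightarrow> sq_summable (f i)) \<Longrightarrow> sq_summable (\<lambda>x. \<Sum>i\<in>I. f i x)"
  by (induction I rule: infinite_finite_induct) (auto intro: sq_summable_add)

lemma sq_summable_of_bool: "sq_summable (\<lambda>x. if x = a then 1 else 0)"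
  unfolding sq_summable_def
  by (rule finite_nonzero_values_imp_summable_on) (auto intro: finite_subset[of _ "{a}"])

lemma l2_bessel_inequality:
  fixes f :: "'a \<Rightarrow> complex" and b :: "'b \<Rightarrow> 'a \<Rightarrow> complex"
  assumes "finite I" "sq_summable f" "\<And>i. i \<in> I \<Longrightarrow> sq_summable (b i)"
    and "\<And>i j. i \<in> I \<Longrightarrow> j \<in> I \<Longrightarrow> l2_inner (b i) (b j) = (if i = j then 1 else 0)"
  shows "(\<Sum>i\<in>I. (cmod (l2_inner f (b i)))\<^sup>2) \<le> (\<Sum>\<^sub>\<infinity>x. (cmod (f x))\<^sup>2)"
proof -
  let ?M = "count_space UNIV :: 'a measure"
  have sq: "integrable ?M (\<lambda>x. (cmod (g x))\<^sup>2)" "(LINT x|?M. (cmod (g x))\<^sup>2) = (\<Sum>\<^sub>\<infinity>x. (cmod (g x))\<^sup>2)"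
    if "sq_summable g" for g :: "'a \<Rightarrow> complex"
    using that integral_count_space_eq_infsum[of "\<lambda>x. (cmod (g x))\<^sup>2"] by (auto simp: sq_summable_def)
  have in_eq: "l2_inner g h = (LINT x|?M. g x * cnj (h x))" if "sq_summable g" "sq_summable h" for g h
    unfolding l2_inner_def
    using that sq_summable_mult_norm[of g "\<lambda>x. cnj (h x)"] integral_count_space_eq_infsum(2) by force
  have "(\<Sum>i\<in>I. (cmod (LINT x|?M. f x * cnj (b i x)))\<^sup>2) \<le> (LINT x|?M. (cmod (f x))\<^sup>2)"
    using assms sq(1) by (intro bessel_inequality) (auto simp flip: in_eq)
  then show ?thesis
    using assms sq(2) by (simp flip: in_eq)
qed

section \<open>Rank-one tensors and the Hilbert--Schmidt norm\<close>

lemma summable_on_times_nonneg: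
  fixes f :: "'a \<Rightarrow> real" and g :: "'b \<Rightarrow> real"
  assumes "f summable_on A" "g summable_on B" "\<And>x. x \<in> A \<Longrightarrow> f x \<ge> 0" "\<And>y. y \<in> B \<Longrightarrow> g y \<ge> 0"
  shows "(\<lambda>(x, y). f x * g y) summable_on A \<times> B"
proof (rule summable_on_SigmaI)
  show "((\<lambda>y. (\<lambda>(x, y). f x * g y) (x, y)) has_sum (f x * infsum g B)) B" for x
    using assms(2) by (auto intro: has_sum_cmult_right)
  show "(\<lambda>x. f x * infsum g B) summable_on A"
    using assms(1) by (rule summable_on_cmult_left)
qed (use assms in auto)

text \<open>Kernel of the rank-one operator \<open>h \<mapsto> l2_inner h g * f\<close>. Tensors
  built from an orthonormal family are orthonormal in the Hilbert--Schmidt inner product.\<close>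

definition tensor :: "('a \<Rightarrow> complex) \<Rightarrow> ('a \<Rightarrow> complex) \<Rightarrow> 'a \<times> 'a \<Rightarrow> complex" where
  "tensor f g p = f (fst p) * cnj (g (snd p))"

lemma sq_summable_tensor:
  assumes "sq_summable f" "sq_summable g"
  shows "sq_summable (tensor f g)"
  using summable_on_times_nonneg[of "\<lambda>x. (cmod (f x))\<^sup>2" UNIV "\<lambda>x. (cmod (g x))\<^sup>2" UNIV] assms
  by (simp add: sq_summable_def tensor_def norm_mult power_mult_distrib case_prod_unfold)

lemma l2_inner_tensor:
  assumes "sq_summable f" "sq_summable g" "sq_summable f'" "sq_summable g'"
  shows "l2_inner (tensor f g) (tensor f' g') = l2_inner f f' * cnj (l2_inner g g')"
proof -
  have "(\<lambda>p. tensor f g p * cnj (tensor f' g' p)) summable_on UNIV \<times> UNIV"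
    using sq_summable_mult_cnj[OF sq_summable_tensor sq_summable_tensor] assms by simp
  then have "l2_inner (tensor f g) (tensor f' g')
      = (\<Sum>\<^sub>\<infinity>x. \<Sum>\<^sub>\<infinity>y. tensor f g (x, y) * cnj (tensor f' g' (x, y)))"
    unfolding l2_inner_def by (subst infsum_Sigma_banach) auto
  also have "\<dots> = (\<Sum>\<^sub>\<infinity>x. \<Sum>\<^sub>\<infinity>y. (f x * cnj (f' x)) * cnj (g y * cnj (g' y)))"
    by (simp add: tensor_def mult_ac)
  also have "\<dots> = l2_inner f f' * cnj (l2_inner g g')"
    unfolding infsum_cmult_right' infsum_cmult_left' l2_inner_def infsum_cnj ..
  finally show ?thesis .
qed

text \<open>Square of the Hilbert--Schmidt norm.\<close>

definition hs_sq :: "('i \<Rightarrow> 'i \<Rightarrow> complex) \<Rightarrow> real" where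
  "hs_sq K = (\<Sum>\<^sub>\<infinity>p. (cmod (K (fst p) (snd p)))\<^sup>2)"

lemma hs_sq_nonneg: "hs_sq K \<ge> 0"
  unfolding hs_sq_def by (intro infsum_nonneg) auto

lemma hilbert_schmidt_eq_0:
  "hilbert_schmidt S K \<Longrightarrow> p \<notin> S \<times> S \<Longrightarrow> K (fst p) (snd p) = 0"
  by (metis hilbert_schmidt_def prod.collapse)

lemma hilbert_schmidt_sq_summable:
  assumes "hilbert_schmidt S K"
  shows "sq_summable (\<lambda>p. K (fst p) (snd p))"
proof -
  have "(\<lambda>p. (cmod (K (fst p) (snd p)))\<^sup>2) summable_on S \<times> S"
    using assms by (simp add: hilbert_schmidt_def case_prod_unfold)
  then show ?thesis
    unfolding sq_summable_def
    by (rule summable_on_cong_neutral[THEN iffD1, rotated -1]) (use hilbert_schmidt_eq_0[OF assms] in auto)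
qed

section \<open>Compressions to orthonormal lists\<close>

lemma orthonormal_list_sq_summable:
  assumes "orthonormal_list S bs" "i < length bs"
  shows "sq_summable (bs ! i)"
proof -
  have m: "bs ! i \<in> l2_space S"
    using assms nth_mem unfolding orthonormal_list_def by blast
  then have "(\<lambda>x. (cmod ((bs ! i) x))\<^sup>2) summable_on S"
    by (simp add: l2_space_def)
  then show ?thesis
    unfolding sq_summable_def
    by (rule summable_on_cong_neutral[THEN iffD1, rotated -1]) (use m in \<open>auto simp: l2_space_def\<close>)
qed

lemma orthonormal_list_inner:
  assumes "orthonormal_list S bs" "i < length bs" "j < length bs"
  shows "l2_inner (bs ! i) (bs ! j) = (if i = j then 1 else 0)"
  using assms unfolding orthonormal_list_def by blast

lemma compression_carrier [simp]: "compression K bs \<in> carrier_mat (length bs) (length bs)"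
  by (simp add: compression_def)

lemma dim_compression [simp]:
  "dim_row (compression K bs) = length bs" "dim_col (compression K bs) = length bs"
  by (simp_all add: compression_def)

text \<open>Iterating the double sum turns a matrix entry into the coefficient of the kernel along a
  rank-one tensor. Compressions thereby become arrays of coefficients, to which Bessel's inequality
  applies.\<close>

lemma compression_entry:
  assumes K: "sq_summable (\<lambda>p. K (fst p) (snd p))"
    and bs: "orthonormal_list S bs" and ij: "i < length bs" "j < length bs"
  shows "compression K bs $$ (i, j) = l2_inner (\<lambda>p. K (fst p) (snd p)) (tensor (bs ! i) (bs ! j))"
proof -
  let ?T = "\<lambda>p. K (fst p) (snd p) * cnj (tensor (bs ! i) (bs ! j) p)"
  have "?T summable_on UNIV \<times> UNIV"
    using sq_summable_mult_cnj[OF K sq_summable_tensor] orthonormal_list_sq_summable[OF bs] ij by simp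
  then have "l2_inner (\<lambda>p. K (fst p) (snd p)) (tensor (bs ! i) (bs ! j)) = (\<Sum>\<^sub>\<infinity>x. \<Sum>\<^sub>\<infinity>y. ?T (x, y))"
    unfolding l2_inner_def by (subst infsum_Sigma_banach) auto
  also have "\<dots> = (\<Sum>\<^sub>\<infinity>x. \<Sum>\<^sub>\<infinity>y. K x y * (bs ! j) y * cnj ((bs ! i) x))"
    by (simp add: tensor_def mult_ac)
  also have "\<dots> = l2_inner (op_apply K (bs ! j)) (bs ! i)"
    unfolding l2_inner_def op_apply_def infsum_cmult_left' ..
  finally show ?thesis
    using ij by (simp add: compression_def)
qed

text \<open>The tensors of members of \<open>bs\<close> are orthonormal, so Bessel's inequality
  bounds the entries by the whole kernel, whatever the length of \<open>bs\<close>.\<close>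

lemma frob_compression_le:
  assumes K: "sq_summable (\<lambda>p. K (fst p) (snd p))" and bs: "orthonormal_list S bs"
  shows "(frob (compression K bs))\<^sup>2 \<le> hs_sq K"
proof -
  let ?N = "length bs"
  have "(frob (compression K bs))\<^sup>2 = (\<Sum>i<?N. \<Sum>j<?N. (cmod (compression K bs $$ (i, j)))\<^sup>2)"
    by (simp add: frob_squared compression_def)
  also have "\<dots> = (\<Sum>p\<in>{..<?N} \<times> {..<?N}. (cmod (compression K bs $$ p))\<^sup>2)"
    by (simp add: sum.cartesian_product case_prod_unfold)
  also have "\<dots> = (\<Sum>p\<in>{..<?N} \<times> {..<?N}.
      (cmod (l2_inner (\<lambda>p. K (fst p) (snd p)) (tensor (bs ! fst p) (bs ! snd p))))\<^sup>2)"
    by (intro sum.cong refl) (auto simp: compression_entry[OF K bs])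
  also have "\<dots> \<le> hs_sq K"
    unfolding hs_sq_def
  proof (rule l2_bessel_inequality)
    fix p q assume "p \<in> {..<?N} \<times> {..<?N}" "q \<in> {..<?N} \<times> {..<?N}"
    then show "l2_inner (tensor (bs ! fst p) (bs ! snd p)) (tensor (bs ! fst q) (bs ! snd q))
        = (if p = q then 1 else 0)"
      by (auto simp: l2_inner_tensor orthonormal_list_inner[OF bs] orthonormal_list_sq_summable[OF bs] split: if_splits)
  qed (use K in \<open>auto intro!: sq_summable_tensor orthonormal_list_sq_summable[OF bs]\<close>)
  finally show ?thesis .
qed

section \<open>Truncation of a kernel to an index set\<close>

definition restrict_kernel :: "'i set \<Rightarrow> ('i \<Rightarrow> 'i \<Rightarrow> complex) \<Rightarrow> 'i \<Rightarrow> 'i \<Rightarrow> complex" where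
  "restrict_kernel F K x y = (if x \<in> F \<and> y \<in> F then K x y else 0)"

definition kernel_tail :: "'i set \<Rightarrow> ('i \<Rightarrow> 'i \<Rightarrow> complex) \<Rightarrow> 'i \<Rightarrow> 'i \<Rightarrow> complex" where
  "kernel_tail F K x y = K x y - restrict_kernel F K x y"

lemma sq_summable_restrict_kernel:
  assumes "sq_summable (\<lambda>p. K (fst p) (snd p))"
  shows "sq_summable (\<lambda>p. restrict_kernel F K (fst p) (snd p))"
    and "sq_summable (\<lambda>p. kernel_tail F K (fst p) (snd p))"
  using assms unfolding sq_summable_def
  by (rule summable_on_comparison_test; simp add: restrict_kernel_def kernel_tail_def)+

lemma hs_sq_restrict_kernel_le:
  assumes "sq_summable (\<lambda>p. K (fst p) (snd p))"
  shows "hs_sq (restrict_kernel F K) \<le> hs_sq K"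
  unfolding hs_sq_def
  using sq_summable_restrict_kernel(1)[OF assms, of F] assms unfolding sq_summable_def
  by (intro infsum_mono) (auto simp: restrict_kernel_def)

lemma hs_sq_kernel_tail:
  "hs_sq (kernel_tail F K) = (\<Sum>\<^sub>\<infinity>p\<in>- (F \<times> F). (cmod (K (fst p) (snd p)))\<^sup>2)"
  unfolding hs_sq_def
  by (rule infsum_cong_neutral) (auto simp: kernel_tail_def restrict_kernel_def)

text \<open>Compression is linear in the kernel, so the two compressions differ by that of the tail.
  Frobenius norms are bounded by Hilbert--Schmidt norms, and the Lipschitz bound for
  \<open>det2_fin\<close> gives an estimate independent of \<open>bs\<close>.\<close>

lemma det2_fin_compression_restrict_close:
  assumes K: "sq_summable (\<lambda>p. K (fst p) (snd p))" and bs: "orthonormal_list S bs"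
    and R: "hs_sq K \<le> R\<^sup>2" "R \<ge> 0" and d: "hs_sq (kernel_tail F K) \<le> d\<^sup>2" "d > 0"
  shows "cmod (det2_fin (compression K bs) - det2_fin (compression (restrict_kernel F K) bs))
    \<le> exp ((R + 1)\<^sup>2 / 2) * d"
proof -
  note KF = sq_summable_restrict_kernel[OF K, of F]
  have diff: "compression K bs - compression (restrict_kernel F K) bs = compression (kernel_tail F K) bs"
  proof (rule eq_matI)
    fix i j assume "i < dim_row (compression (kernel_tail F K) bs)" "j < dim_col (compression (kernel_tail F K) bs)"
    then have ij: "i < length bs" "j < length bs"
      by (simp_all add: compression_def)
    have t: "sq_summable (tensor (bs ! i) (bs ! j))"
      using ij by (intro sq_summable_tensor orthonormal_list_sq_summable[OF bs])
    have "l2_inner (\<lambda>p. K (fst p) (snd p)) (tensor (bs ! i) (bs ! j))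
      = l2_inner (\<lambda>p. kernel_tail F K (fst p) (snd p)) (tensor (bs ! i) (bs ! j))
        + l2_inner (\<lambda>p. restrict_kernel F K (fst p) (snd p)) (tensor (bs ! i) (bs ! j))"
      unfolding l2_inner_def
      using sq_summable_mult_cnj[OF KF(1) t] sq_summable_mult_cnj[OF KF(2) t]
      by (subst infsum_add[symmetric]) (auto simp: kernel_tail_def algebra_simps)
    then show "(compression K bs - compression (restrict_kernel F K) bs) $$ (i, j)
        = compression (kernel_tail F K) bs $$ (i, j)"
      using ij
      by (simp add: compression_entry[OF K bs] compression_entry[OF KF(1) bs] compression_entry[OF KF(2) bs])
  qed (simp_all add: compression_def)
  have "frob (compression K bs) \<le> R"
    by (rule power2_le_imp_le[OF order.trans[OF frob_compression_le[OF K bs] R(1)] R(2)])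
  moreover have "frob (compression (restrict_kernel F K) bs) \<le> R"
    by (rule power2_le_imp_le[OF order.trans[OF frob_compression_le[OF KF(1) bs]
      order.trans[OF hs_sq_restrict_kernel_le[OF K] R(1)]] R(2)])
  moreover have "frob (compression K bs - compression (restrict_kernel F K) bs) \<le> d"
    unfolding diff using power2_le_imp_le[OF order.trans[OF frob_compression_le[OF KF(2) bs] d(1)]] d(2)
    by simp
  ultimately show ?thesis
    using det2_fin_lipschitz[of "compression (restrict_kernel F K) bs" "length bs" "compression K bs" R d] d
    by (simp add: norm_minus_commute)
qed

section \<open>Convergence of the projections of an exhaustion\<close>

lemma has_sum_finite_sum:
  fixes f :: "'b \<Rightarrow> 'a \<Rightarrow> 'c::topological_comm_monoid_add"
  assumes "finite I" "\<And>i. i \<in> I \<Longrightarrow> (f i has_sum s i) A"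
  shows "((\<lambda>x. \<Sum>i\<in>I. f i x) has_sum (\<Sum>i\<in>I. s i)) A"
  using assms by (induction I rule: finite_induct) (auto intro: has_sum_add)

text \<open>The sum is the \<open>(x, y)\<close> entry of the orthogonal projection onto
  \<open>lspan (bss N)\<close>. Density supplies some \<open>g\<close> in
  \<open>lspan (bss N0)\<close> close to the unit vector \<open>u\<close> at \<open>y\<close>;
  nestedness makes all later projections fix \<open>g\<close>, so only the small remainder
  \<open>w = u - g\<close> contributes.\<close>

lemma admissible_exhaustion_completeness:
  assumes adm: "admissible_exhaustion S bss" and y: "y \<in> S"
  shows "(\<lambda>N. \<Sum>i<length (bss N). (bss N ! i) x * cnj ((bss N ! i) y))
    \<longlonglongrightarrow> (if x = y then 1 else 0)"
proof (rule LIMSEQ_I)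
  fix e :: real assume e: "e > 0"
  define u :: "'a \<Rightarrow> complex" where "u z = (if z = y then 1 else 0)" for z
  have sq_u: "sq_summable u"
    unfolding u_def by (rule sq_summable_of_bool)
  have "u \<in> l2_space S"
    using y summable_on_subset_banach[OF sq_u[unfolded sq_summable_def], of S]
    by (simp add: l2_space_def u_def)
  \<comment> \<open>Half of \<open>e\<close>, because the remainder enters twice: projected and
    unprojected.\<close>
  then obtain N0 g where g: "g \<in> lspan (bss N0)" "l2_norm (\<lambda>z. u z - g z) < e / 2"
    using adm half_gt_zero[OF e] unfolding admissible_exhaustion_def by blast
  have "norm ((\<Sum>i<length (bss N). (bss N ! i) x * cnj ((bss N ! i) y)) - (if x = y then 1 else 0)) < e"
    if "N \<ge> N0" for N
  proof -
    define bs where "bs = bss N"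
    have bs: "orthonormal_list S bs"
      using adm by (simp add: bs_def admissible_exhaustion_def)
    have "lspan (bss N0) \<subseteq> lspan bs"
      unfolding bs_def
      by (rule lift_Suc_mono_le[of "\<lambda>N. lspan (bss N)"])
        (use adm that in \<open>auto simp: admissible_exhaustion_def\<close>)
    then obtain c where c: "g = (\<lambda>z. \<Sum>i<length bs. c i * (bs ! i) z)"
      using g(1) unfolding lspan_def by blast
    note sq = orthonormal_list_sq_summable[OF bs]
    have sq_g: "sq_summable g"
      unfolding c using sq by (auto intro!: sq_summable_sum sq_summable_cmult)
    define w where "w z = u z - g z" for z
    have sq_w: "sq_summable w"
      unfolding w_def using sq_u sq_g by (rule sq_summable_diff)
    have norm_w: "(\<Sum>\<^sub>\<infinity>z. (cmod (w z))\<^sup>2) = (l2_norm w)\<^sup>2"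
      unfolding l2_norm_def by (simp add: infsum_nonneg)
    have u_in: "l2_inner (\<lambda>z. if z = t then 1 else 0) f = cnj (f t)" for t :: 'a and f
    proof -
      have "l2_inner (\<lambda>z. if z = t then 1 else 0) f = (\<Sum>\<^sub>\<infinity>z\<in>{t}. cnj (f z))"
        unfolding l2_inner_def by (rule infsum_cong_neutral) auto
      then show ?thesis by simp
    qed
    have g_in: "l2_inner g (bs ! i) = c i" if i: "i < length bs" for i
    proof -
      have "l2_inner g (bs ! i) = (\<Sum>\<^sub>\<infinity>z. \<Sum>j<length bs. c j * ((bs ! j) z * cnj ((bs ! i) z)))"
        unfolding l2_inner_def c by (simp add: sum_distrib_right mult.assoc)
      also have "\<dots> = (\<Sum>j<length bs. \<Sum>\<^sub>\<infinity>z. c j * ((bs ! j) z * cnj ((bs ! i) z)))"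
        using sq i
        by (intro infsumI has_sum_finite_sum has_sum_infsum summable_on_cmult_right sq_summable_mult_cnj) auto
      also have "\<dots> = (\<Sum>j<length bs. c j * (if j = i then 1 else 0))"
        unfolding infsum_cmult_right' l2_inner_def[symmetric]
        using i by (intro sum.cong refl) (simp add: orthonormal_list_inner[OF bs])
      finally show ?thesis using i by (simp add: if_distrib cong: if_cong)
    qed
    have w_in: "l2_inner w (bs ! i) = cnj ((bs ! i) y) - c i" if i: "i < length bs" for i
    proof -
      have "l2_inner u (bs ! i) = l2_inner w (bs ! i) + l2_inner g (bs ! i)"
        unfolding l2_inner_def
        using sq_summable_mult_cnj[OF sq_w sq[OF i]] sq_summable_mult_cnj[OF sq_g sq[OF i]]
        by (subst infsum_add[symmetric]) (auto simp: w_def algebra_simps)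
      then show ?thesis
        using g_in[OF i] u_in[of y "bs ! i"] by (simp add: u_def[abs_def])
    qed
    have wx: "cmod (w x) \<le> l2_norm w"
    proof (rule power2_le_imp_le)
      show "(cmod (w x))\<^sup>2 \<le> (l2_norm w)\<^sup>2"
        using finite_sum_le_infsum[of "\<lambda>z. (cmod (w z))\<^sup>2" UNIV "{x}"] sq_w
        by (simp add: norm_w sq_summable_def)
    qed (simp add: l2_norm_def infsum_nonneg)
    \<comment> \<open>Coordinate \<open>x\<close> of the projection of \<open>w\<close>, by
      Cauchy--Schwarz: Bessel's inequality for \<open>w\<close> bounds the first factor, Bessel's
      inequality for the unit vector at \<open>x\<close> the second.\<close>
    have "cmod (\<Sum>i<length bs. l2_inner w (bs ! i) * (bs ! i) x)
        \<le> (\<Sum>i<length bs. \<bar>cmod (l2_inner w (bs ! i))\<bar> * \<bar>cmod ((bs ! i) x)\<bar>)"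
      by (rule order.trans[OF norm_sum]) (simp add: norm_mult)
    also have "\<dots> \<le> L2_set (\<lambda>i. cmod (l2_inner w (bs ! i))) {..<length bs}
        * L2_set (\<lambda>i. cmod ((bs ! i) x)) {..<length bs}"
      by (rule L2_set_mult_ineq)
    also have "\<dots> \<le> l2_norm w * 1"
    proof (rule mult_mono)
      show "L2_set (\<lambda>i. cmod (l2_inner w (bs ! i))) {..<length bs} \<le> l2_norm w"
        unfolding L2_set_def l2_norm_def
        using sq sq_w orthonormal_list_inner[OF bs]
        by (intro real_sqrt_le_mono l2_bessel_inequality) auto
      have "(\<Sum>i<length bs. (cmod (l2_inner (\<lambda>z. if z = x then 1 else 0) (bs ! i)))\<^sup>2)
          \<le> (\<Sum>\<^sub>\<infinity>z. (cmod (if z = x then 1 else 0))\<^sup>2)"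
        using sq sq_summable_of_bool orthonormal_list_inner[OF bs]
        by (intro l2_bessel_inequality) auto
      also have "\<dots> = (\<Sum>\<^sub>\<infinity>z\<in>{x}. 1)"
        by (rule infsum_cong_neutral) auto
      finally show "L2_set (\<lambda>i. cmod ((bs ! i) x)) {..<length bs} \<le> 1"
        by (simp add: L2_set_def u_in)
    qed (simp_all add: l2_norm_def infsum_nonneg L2_set_nonneg)
    finally have sum_w: "cmod (\<Sum>i<length bs. l2_inner w (bs ! i) * (bs ! i) x) \<le> l2_norm w"
      by simp
    \<comment> \<open>The contribution of \<open>g\<close> cancels, since its coefficients
      \<open>c i\<close> reproduce it.\<close>
    have eq: "(\<Sum>i<length bs. (bs ! i) x * cnj ((bs ! i) y)) - u x
        = (\<Sum>i<length bs. l2_inner w (bs ! i) * (bs ! i) x) - w x"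
      by (simp add: w_in w_def c algebra_simps sum_subtractf)
    have "cmod ((\<Sum>i<length bs. (bs ! i) x * cnj ((bs ! i) y)) - u x) \<le> l2_norm w + l2_norm w"
      unfolding eq using sum_w wx norm_triangle_ineq4[of "\<Sum>i<length bs. l2_inner w (bs ! i) * (bs ! i) x" "w x"]
      by linarith
    also have "\<dots> < e"
      using g(2) unfolding w_def[abs_def] by simp
    finally show ?thesis
      by (simp add: bs_def u_def)
  qed
  then show "\<exists>N0. \<forall>N\<ge>N0. norm ((\<Sum>i<length (bss N). (bss N ! i) x * cnj ((bss N ! i) y))
      - (if x = y then 1 else 0)) < e"
    by blast
qed

definition kernel_mat :: "('i \<Rightarrow> 'i \<Rightarrow> complex) \<Rightarrow> 'i list \<Rightarrow> complex mat" where
  "kernel_mat K xs = mat (length xs) (length xs) (\<lambda>(a, b). K (xs ! a) (xs ! b))"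

lemma sum_set_conv_nth:
  "distinct xs \<Longrightarrow> (\<Sum>x\<in>set xs. f x) = (\<Sum>a<length xs. f (xs ! a))"
  by (rule sum.reindex_bij_betw[symmetric]) (simp add: bij_betw_nth)

text \<open>Sylvester's identity moves the determinant of a compression of a finitely supported kernel
  to the support, where the dimension is fixed and the frame operator of the exhaustion converges
  entrywise to the identity.\<close>

lemma det2_fin_compression_restrict_tendsto:
  assumes adm: "admissible_exhaustion S bss" and K: "sq_summable (\<lambda>p. K (fst p) (snd p))"
    and xs: "distinct xs" "set xs \<subseteq> S"
  shows "(\<lambda>N. det2_fin (compression (restrict_kernel (set xs) K) (bss N)))
    \<longlonglongrightarrow> det2_fin (kernel_mat K xs)"
proof -
  define m where "m = length xs"
  \<comment> \<open>\<open>B N\<close> holds the values of the basis vectors on the support;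
    \<open>C N\<close> is its adjoint.\<close>
  define B where "B N = mat m (length (bss N)) (\<lambda>(a, j). (bss N ! j) (xs ! a))" for N
  define C where "C N = mat (length (bss N)) m (\<lambda>(i, a). cnj ((bss N ! i) (xs ! a)))" for N
  define G where "G = kernel_mat K xs"
  let ?KF = "restrict_kernel (set xs) K"
  note KF = sq_summable_restrict_kernel(1)[OF K, of "set xs"]
  have G: "G \<in> carrier_mat m m" and B: "B N \<in> carrier_mat m (length (bss N))"
    and C: "C N \<in> carrier_mat (length (bss N)) m" for N
    by (simp_all add: G_def kernel_mat_def B_def C_def m_def)
  \<comment> \<open>The restricted kernel vanishes off \<open>set xs\<close>, so each entry is a
    finite double sum, that is, an entry of a product of three matrices.\<close>
  have eq: "compression ?KF (bss N) = C N * (G * B N)" for N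
  proof (rule eq_matI)
    fix i j assume "i < dim_row (C N * (G * B N))" "j < dim_col (C N * (G * B N))"
    then have ij: "i < length (bss N)" "j < length (bss N)"
      using B[of N] C[of N] by auto
    have bs: "orthonormal_list S (bss N)"
      using adm by (simp add: admissible_exhaustion_def)
    have "compression ?KF (bss N) $$ (i, j) = (\<Sum>\<^sub>\<infinity>p\<in>set xs \<times> set xs.
        K (fst p) (snd p) * cnj (tensor (bss N ! i) (bss N ! j) p))"
      unfolding compression_entry[OF KF bs ij] l2_inner_def
      by (rule infsum_cong_neutral) (auto simp: restrict_kernel_def)
    also have "\<dots> = (\<Sum>x\<in>set xs. \<Sum>y\<in>set xs. K x y * cnj (tensor (bss N ! i) (bss N ! j) (x, y)))"
      by (simp add: sum.cartesian_product case_prod_unfold)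
    also have "\<dots> = (\<Sum>a<m. \<Sum>b<m.
        K (xs ! a) (xs ! b) * cnj (tensor (bss N ! i) (bss N ! j) (xs ! a, xs ! b)))"
      by (simp add: sum_set_conv_nth[OF xs(1)] m_def)
    also have "\<dots> = (C N * (G * B N)) $$ (i, j)"
      using ij by (auto simp: scalar_prod_def lessThan_atLeast0 tensor_def G_def kernel_mat_def
        B_def C_def m_def sum_distrib_left mult_ac intro!: sum.cong)
    finally show "compression ?KF (bss N) $$ (i, j) = (C N * (G * B N)) $$ (i, j)" .
  qed (use B[of N] C[of N] in auto)
  \<comment> \<open>Cycling \<open>C N\<close> to the right replaces the varying dimension
    \<open>length (bss N)\<close> by the fixed \<open>m\<close>.\<close>
  have "det2_fin (compression ?KF (bss N)) = det2_fin (G * (B N * C N))" for N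
    unfolding eq assoc_mult_mat[OF G B C, symmetric]
    by (rule det2_fin_mult_commute[OF C mult_carrier_mat[OF G B]])
  moreover have "(\<lambda>N. det2_fin (G * (B N * C N))) \<longlonglongrightarrow> det2_fin G"
  proof (rule tendsto_det2_fin)
    show "G * (B N * C N) \<in> carrier_mat m m" for N
      by (rule mult_carrier_mat[OF G mult_carrier_mat[OF B C]])
    fix a b assume ab: "a < m" "b < m"
    \<comment> \<open>\<open>B N * C N\<close> is the block on the support of the projection onto
      \<open>lspan (bss N)\<close>.\<close>
    have BC: "(\<lambda>N. (B N * C N) $$ (c, b)) \<longlonglongrightarrow> (if c = b then 1 else 0)" if "c < m" for c
    proof -
      have "(B N * C N) $$ (c, b) = (\<Sum>i<length (bss N). (bss N ! i) (xs ! c) * cnj ((bss N ! i) (xs ! b)))" for N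
        using that ab by (auto simp: scalar_prod_def lessThan_atLeast0 B_def C_def)
      moreover have "(xs ! c = xs ! b) = (c = b)" "xs ! b \<in> S"
        using that ab xs by (auto simp: m_def nth_eq_iff_index_eq)
      ultimately show ?thesis
        using admissible_exhaustion_completeness[OF adm, of "xs ! b" "xs ! c"] by simp
    qed
    have "(G * (B N * C N)) $$ (a, b) = (\<Sum>c<m. G $$ (a, c) * (B N * C N) $$ (c, b))" for N
    proof -
      define Q where "Q = B N * C N"
      have "Q \<in> carrier_mat m m"
        unfolding Q_def by (rule mult_carrier_mat[OF B C])
      then show ?thesis
        using ab G unfolding Q_def[symmetric] by (auto simp: scalar_prod_def lessThan_atLeast0)
    qed
    moreover have "(\<lambda>N. \<Sum>c<m. G $$ (a, c) * (B N * C N) $$ (c, b))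
        \<longlonglongrightarrow> (\<Sum>c<m. G $$ (a, c) * (if c = b then 1 else 0))"
      by (intro tendsto_intros BC) auto
    moreover have "(\<Sum>c<m. G $$ (a, c) * (if c = b then 1 else 0)) = G $$ (a, b)"
      using ab by (simp add: if_distrib cong: if_cong)
    ultimately show "(\<lambda>N. (G * (B N * C N)) $$ (a, b)) \<longlonglongrightarrow> G $$ (a, b)"
      by simp
  qed (rule G)
  ultimately show ?thesis
    by (simp add: G_def)
qed

text \<open>The truncation error is bounded uniformly in \<open>N\<close>, and the truncated
  compressions converge. The comparison value \<open>det2_fin (kernel_mat K xs)\<close> does not
  mention \<open>bss\<close>, which later makes limits along different exhaustions agree.\<close>

lemma eventually_det2_fin_compression_close:
  assumes adm: "admissible_exhaustion S bss" and K: "sq_summable (\<lambda>p. K (fst p) (snd p))"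
    and xs: "distinct xs" "set xs \<subseteq> S"
    and R: "hs_sq K \<le> R\<^sup>2" "R \<ge> 0" and d: "hs_sq (kernel_tail (set xs) K) \<le> d\<^sup>2" "d > 0"
    and e: "e > 0"
  shows "eventually (\<lambda>N. cmod (det2_fin (compression K (bss N)) - det2_fin (kernel_mat K xs))
    < exp ((R + 1)\<^sup>2 / 2) * d + e) sequentially"
proof -
  have "eventually (\<lambda>N. dist (det2_fin (compression (restrict_kernel (set xs) K) (bss N)))
      (det2_fin (kernel_mat K xs)) < e) sequentially"
    using tendstoD[OF det2_fin_compression_restrict_tendsto[OF adm K xs] e] .
  then show ?thesis
  proof eventually_elim
    case (elim N)
    have "orthonormal_list S (bss N)"
      using adm by (simp add: admissible_exhaustion_def)
    from det2_fin_compression_restrict_close[OF K this R d] elim show ?case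
      unfolding dist_norm
      using norm_triangle_ineq[of "det2_fin (compression K (bss N))
          - det2_fin (compression (restrict_kernel (set xs) K) (bss N))"
        "det2_fin (compression (restrict_kernel (set xs) K) (bss N)) - det2_fin (kernel_mat K xs)"]
      by simp
  qed
qed

section \<open>Tails of dominated kernels and existence of the determinant\<close>

text \<open>The bound involves \<open>W\<close> and \<open>P\<close> alone, besides
  \<open>S\<close>: one finite \<open>P\<close> serves every kernel dominated by \<open>W\<close>
  and every finite \<open>F\<close> whose square contains \<open>P\<close>.\<close>

lemma kernel_tail_le:
  assumes K: "hilbert_schmidt S K" and W: "W summable_on S \<times> S"
    and le: "\<And>p. p \<in> S \<times> S \<Longrightarrow> (cmod (K (fst p) (snd p)))\<^sup>2 \<le> W p"
    and F: "finite F" "F \<subseteq> S" "P \<subseteq> F \<times> F"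
  shows "hs_sq (kernel_tail F K) \<le> infsum W (S \<times> S) - sum W P"
proof -
  let ?k = "\<lambda>p. (cmod (K (fst p) (snd p)))\<^sup>2"
  have sq: "sq_summable (\<lambda>p. K (fst p) (snd p))"
    using K by (rule hilbert_schmidt_sq_summable)
  have "hs_sq (kernel_tail F K) = infsum ?k (S \<times> S - F \<times> F)"
    unfolding hs_sq_kernel_tail
    by (rule infsum_cong_neutral) (use hilbert_schmidt_eq_0[OF K] in auto)
  also have "\<dots> \<le> infsum W (S \<times> S - F \<times> F)"
  proof (rule infsum_mono)
    show "?k summable_on S \<times> S - F \<times> F"
      using sq unfolding sq_summable_def by (rule summable_on_subset_banach) simp
    show "W summable_on S \<times> S - F \<times> F"
      using W by (rule summable_on_subset_banach) auto
  qed (use le in auto)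
  also have "\<dots> = infsum W (S \<times> S) - sum W (F \<times> F)"
    using W F by (subst infsum_Diff) auto
  also have "\<dots> \<le> infsum W (S \<times> S) - sum W P"
  proof (intro diff_left_mono sum_mono2)
    \<comment> \<open>\<open>W\<close> is nonnegative on \<open>S \<times> S\<close> because it
      dominates squares there.\<close>
    fix p assume "p \<in> F \<times> F - P"
    then show "0 \<le> W p"
      using F(2) by (intro order.trans[OF zero_le_power2 le]) auto
  qed (use F in auto)
  finally show ?thesis .
qed

lemma kernel_tail_small:
  assumes K: "hilbert_schmidt S K" and d: "d > 0"
  obtains xs where "distinct xs" "set xs \<subseteq> S" "hs_sq (kernel_tail (set xs) K) \<le> d\<^sup>2"
proof -
  let ?k = "\<lambda>p. (cmod (K (fst p) (snd p)))\<^sup>2"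
  have sm: "?k summable_on S \<times> S"
    using K by (simp add: hilbert_schmidt_def case_prod_unfold)
  obtain P where P: "finite P" "P \<subseteq> S \<times> S" "dist (sum ?k P) (infsum ?k (S \<times> S)) \<le> d\<^sup>2"
    using infsum_finite_approximation[OF sm, of "d\<^sup>2"] d by auto
  \<comment> \<open>Both coordinate projections are taken, so that \<open>P\<close> fits into the
    square of \<open>F\<close>. The squared kernel then serves as its own dominating weight.\<close>
  define F where "F = fst ` P \<union> snd ` P"
  have F: "finite F" "F \<subseteq> S" "P \<subseteq> F \<times> F"
    using P by (force simp: F_def)+
  obtain xs where xs: "set xs = F" "distinct xs"
    using finite_distinct_list[OF F(1)] by blast
  have "hs_sq (kernel_tail F K) \<le> d\<^sup>2"
    using kernel_tail_le[OF K sm order_refl F] P(3) by (simp add: dist_real_def)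
  then show ?thesis
    using that xs F by auto
qed

text \<open>Justifies the definite description in \<open>det2_I_minus\<close>. For each
  \<open>e\<close> a finite block supplies one value \<open>k\<close> near which every exhaustion
  eventually stays, so each sequence is Cauchy and all share one limit.\<close>

lemma det2_I_minus_limit:
  assumes K: "hilbert_schmidt S K" and adm: "admissible_exhaustion S bss"
  shows "(\<lambda>N. det2_fin (compression K (bss N))) \<longlonglongrightarrow> det2_I_minus S K"
proof -
  define s where "s bss N = det2_fin (compression K (bss N))" for bss and N :: nat
  have sq: "sq_summable (\<lambda>p. K (fst p) (snd p))"
    using K by (rule hilbert_schmidt_sq_summable)
  define R where "R = sqrt (hs_sq K)"
  have R: "hs_sq K \<le> R\<^sup>2" "R \<ge> 0"
    by (simp_all add: R_def hs_sq_nonneg)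
  have close: "\<exists>k. \<forall>bss. admissible_exhaustion S bss \<longrightarrow> eventually (\<lambda>N. cmod (s bss N - k) < e) sequentially"
    if "e > 0" for e
  proof -
    \<comment> \<open>The Lipschitz constant times \<open>d\<close> is \<open>e / 2\<close>, the
      share of the truncation; the other \<open>e / 2\<close> goes to the limit of the truncated
      determinants.\<close>
    define d where "d = e / 2 / exp ((R + 1)\<^sup>2 / 2)"
    have d: "d > 0" "exp ((R + 1)\<^sup>2 / 2) * d + e / 2 = e"
      using that by (simp_all add: d_def)
    obtain xs where xs: "distinct xs" "set xs \<subseteq> S" "hs_sq (kernel_tail (set xs) K) \<le> d\<^sup>2"
      using kernel_tail_small[OF K d(1)] by blast
    show ?thesis
      unfolding s_def
      using eventually_det2_fin_compression_close[OF _ sq xs(1,2) R xs(3) d(1), of _ "e / 2"] that d(2)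
      by (intro exI[of _ "det2_fin (kernel_mat K xs)"]) auto
  qed
  have "Cauchy (s bss)"
  proof (rule CauchyI)
    fix e :: real assume "e > 0"
    then obtain k where "eventually (\<lambda>N. cmod (s bss N - k) < e / 2) sequentially"
      using close[of "e / 2"] adm by auto
    then obtain N0 where N0: "\<And>N. N \<ge> N0 \<Longrightarrow> cmod (s bss N - k) < e / 2"
      by (auto simp: eventually_sequentially)
    have "norm (s bss m - s bss n) < e" if "m \<ge> N0" "n \<ge> N0" for m n
      using N0[OF that(1)] N0[OF that(2)] norm_triangle_ineq4[of "s bss m - k" "s bss n - k"] by simp
    then show "\<exists>M. \<forall>m\<ge>M. \<forall>n\<ge>M. norm (s bss m - s bss n) < e"
      by blast
  qed
  then obtain D where D: "s bss \<longlonglongrightarrow> D"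
    using Cauchy_convergent convergent_def by blast
  have all: "s bss' \<longlonglongrightarrow> D" if adm': "admissible_exhaustion S bss'" for bss'
  proof (rule tendstoI)
    fix e :: real assume "e > 0"
    then obtain k where k: "eventually (\<lambda>N. cmod (s bss N - k) < e / 3) sequentially"
      "eventually (\<lambda>N. cmod (s bss' N - k) < e / 3) sequentially"
      using close[of "e / 3"] adm adm' by auto
    have "eventually (\<lambda>N. dist (s bss N) D < e / 3) sequentially"
      using tendstoD[OF D, of "e / 3"] \<open>e > 0\<close> by simp
    with k show "eventually (\<lambda>N. dist (s bss' N) D < e) sequentially"
    proof eventually_elim
      case (elim N)
      have "s bss' N - D = (s bss' N - k) - (s bss N - k) + (s bss N - D)"
        by simp
      also have "cmod \<dots> \<le> cmod (s bss' N - k) + cmod (s bss N - k) + cmod (s bss N - D)"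
        by (intro norm_triangle_mono norm_triangle_ineq4 order_refl)
      finally show ?case
        using elim by (simp add: dist_norm)
    qed
  qed
  have "det2_I_minus S K = (THE D. \<forall>bss. admissible_exhaustion S bss \<longrightarrow> s bss \<longlonglongrightarrow> D)"
    using K by (simp add: det2_I_minus_def s_def[abs_def])
  \<comment> \<open>Uniqueness comes from the given exhaustion \<open>bss\<close>, along which any
    candidate must be the limit.\<close>
  also have "\<dots> = D"
    using all adm LIMSEQ_unique by (intro the_equality) blast+
  finally show ?thesis
    using D unfolding s_def[abs_def] by simp
qed

text \<open>The estimate for compressions holds for all large \<open>N\<close> with a constant
  independent of \<open>N\<close>, so it survives the limit; the slack \<open>e\<close> is removed
  at the end.\<close>

lemma det2_I_minus_close:
  assumes K: "hilbert_schmidt S K" and adm: "admissible_exhaustion S bss"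
    and xs: "distinct xs" "set xs \<subseteq> S"
    and R: "hs_sq K \<le> R\<^sup>2" "R \<ge> 0" and d: "hs_sq (kernel_tail (set xs) K) \<le> d\<^sup>2" "d > 0"
  shows "cmod (det2_fin (kernel_mat K xs) - det2_I_minus S K) \<le> exp ((R + 1)\<^sup>2 / 2) * d"
proof (rule field_le_epsilon)
  fix e :: real assume "e > 0"
  have "cmod (det2_I_minus S K - det2_fin (kernel_mat K xs)) \<le> exp ((R + 1)\<^sup>2 / 2) * d + e"
  proof (rule tendsto_upperbound)
    show "(\<lambda>N. cmod (det2_fin (compression K (bss N)) - det2_fin (kernel_mat K xs)))
      \<longlonglongrightarrow> cmod (det2_I_minus S K - det2_fin (kernel_mat K xs))"
      by (intro tendsto_intros det2_I_minus_limit[OF K adm])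
    show "eventually (\<lambda>N. cmod (det2_fin (compression K (bss N)) - det2_fin (kernel_mat K xs))
      \<le> exp ((R + 1)\<^sup>2 / 2) * d + e) sequentially"
      using eventually_det2_fin_compression_close[OF adm hilbert_schmidt_sq_summable[OF K] xs R d \<open>e > 0\<close>]
      by (auto elim: eventually_mono)
  qed simp
  then show "cmod (det2_fin (kernel_mat K xs) - det2_I_minus S K) \<le> exp ((R + 1)\<^sup>2 / 2) * d + e"
    by (simp add: norm_minus_commute)
qed

section \<open>The Fourier exhaustion\<close>

abbreviation unit_vec_fun :: "'i \<Rightarrow> 'i \<Rightarrow> complex" where
  "unit_vec_fun p \<equiv> (\<lambda>q. if q = p then 1 else 0)"

lemma op_apply_unit: "op_apply K (unit_vec_fun b) x = K x b"
proof -
  have "op_apply K (unit_vec_fun b) x = (\<Sum>\<^sub>\<infinity>y\<in>{b}. K x y)"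
    unfolding op_apply_def by (rule infsum_cong_neutral) auto
  then show ?thesis by simp
qed

lemma l2_inner_unit: "l2_inner f (unit_vec_fun a) = f a"
proof -
  have "l2_inner f (unit_vec_fun a) = (\<Sum>\<^sub>\<infinity>x\<in>{a}. f x)"
    unfolding l2_inner_def by (rule infsum_cong_neutral) auto
  then show ?thesis by simp
qed

text \<open>Brings the truncated determinant \<open>D_sigma_J\<close> into the form of a finite
  block, to which \<open>det2_I_minus_close\<close> applies.\<close>

lemma compression_unit: "compression K (map unit_vec_fun xs) = kernel_mat K xs"
  by (rule eq_matI) (simp_all add: compression_def kernel_mat_def l2_inner_unit op_apply_unit)

lemma lspan_unit:
  assumes "distinct xs"
  shows "lspan (map unit_vec_fun xs) = {f. \<forall>x. x \<notin> set xs \<longrightarrow> f x = 0}"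
proof -
  have span: "lspan (map unit_vec_fun xs) =
      {\<lambda>x. \<Sum>i<length xs. if x = xs ! i then c i else 0 | c. True}"
    by (simp add: lspan_def mult_delta_right cong: if_cong)
  show ?thesis
  proof (intro equalityI subsetI)
    fix f assume "f \<in> lspan (map unit_vec_fun xs)"
    then obtain c where f: "f = (\<lambda>x. \<Sum>i<length xs. if x = xs ! i then c i else 0)"
      unfolding span by blast
    have "f x = 0" if "x \<notin> set xs" for x
      unfolding f by (rule sum.neutral) (use that in auto)
    then show "f \<in> {f. \<forall>x. x \<notin> set xs \<longrightarrow> f x = 0}"
      by simp
  next
    fix f :: "'a \<Rightarrow> complex" assume "f \<in> {f. \<forall>x. x \<notin> set xs \<longrightarrow> f x = 0}"
    then have f: "\<And>x. x \<notin> set xs \<Longrightarrow> f x = 0"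
      by simp
    have "(\<Sum>i<length xs. if x = xs ! i then f (xs ! i) else 0) = f x" for x
    proof -
      have "(\<Sum>i<length xs. if x = xs ! i then f (xs ! i) else 0) = (\<Sum>y\<in>set xs. if x = y then f y else 0)"
        by (rule sum_set_conv_nth[OF assms, symmetric])
      also have "\<dots> = f x"
        using f[of x] by simp
      finally show ?thesis .
    qed
    then show "f \<in> lspan (map unit_vec_fun xs)"
      unfolding span by (auto intro!: exI[of _ "\<lambda>i. f (xs ! i)"])
  qed
qed

text \<open>Enumerated in the order of the comprehension in \<open>HJ_basis\<close>, so that
  \<open>HJ_basis_eq\<close> is an equality of lists.\<close>

definition mode_list :: "nat \<Rightarrow> nat \<Rightarrow> (int \<times> nat) list" where
  "mode_list n J = List.product [- int J..int J] [0..<n]"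

lemma HJ_basis_eq: "HJ_basis n J = map unit_vec_fun (mode_list n J)"
  by (simp add: HJ_basis_def mode_list_def product_concat_map map_concat comp_def)

lemma distinct_mode_list: "distinct (mode_list n J)"
  by (simp add: mode_list_def distinct_product)

lemma set_mode_list: "set (mode_list n J) = {- int J..int J} \<times> {..<n}"
  by (auto simp: mode_list_def)

lemma finite_subset_mode_list:
  assumes "finite P" "P \<subseteq> idx_set n"
  shows "\<exists>J0. \<forall>J\<ge>J0. P \<subseteq> set (mode_list n J)"
proof (intro exI allI impI)
  \<comment> \<open>The sum of all \<open>\<bar>fst p\<bar>\<close> stands in for their maximum and
    makes sense for empty \<open>P\<close> too.\<close>
  fix J assume J: "J \<ge> nat (\<Sum>p\<in>P. \<bar>fst p\<bar>)"
  show "P \<subseteq> set (mode_list n J)"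
  proof
    fix p assume p: "p \<in> P"
    have "\<bar>fst p\<bar> \<le> (\<Sum>p\<in>P. \<bar>fst p\<bar>)"
      by (rule member_le_sum[OF p]) (use assms(1) in simp_all)
    then have "\<bar>fst p\<bar> \<le> int J"
      using J by linarith
    moreover have "snd p < n"
      using p assms(2) by (auto simp: idx_set_def)
    ultimately show "p \<in> set (mode_list n J)"
      by (cases p) (simp add: set_mode_list abs_le_iff)
  qed
qed

text \<open>Density holds because a square-summable function is approximated by its truncations to
  finitely many modes. This supplies the exhaustion that \<open>det2_I_minus_close\<close> asks
  for.\<close>

lemma admissible_HJ_basis: "admissible_exhaustion (idx_set n) (HJ_basis n)"
  unfolding admissible_exhaustion_def
proof (intro conjI allI ballI impI)
  fix N
  have "unit_vec_fun p \<in> l2_space (idx_set n)" if "p \<in> idx_set n" for p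
    using that summable_on_subset_banach[OF sq_summable_of_bool[of p, unfolded sq_summable_def], of "idx_set n"]
    by (simp add: l2_space_def)
  then show "orthonormal_list (idx_set n) (HJ_basis n N)"
    unfolding orthonormal_list_def HJ_basis_eq
    by (auto simp: set_mode_list idx_set_def l2_inner_unit
        nth_eq_iff_index_eq[OF distinct_mode_list[of n N]])
  show "lspan (HJ_basis n N) \<subseteq> lspan (HJ_basis n (Suc N))"
    unfolding HJ_basis_eq lspan_unit[OF distinct_mode_list] by (auto simp: set_mode_list)
next
  fix f :: "int \<times> nat \<Rightarrow> complex" and e :: real
  assume f: "f \<in> l2_space (idx_set n)" and e: "e > 0"
  let ?k = "\<lambda>x. (cmod (f x))\<^sup>2"
  have sm: "?k summable_on idx_set n"
    using f by (simp add: l2_space_def)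
  \<comment> \<open>The error is measured in the squared norm; the factor one half leaves room for
    the strict inequality.\<close>
  obtain P where P: "finite P" "P \<subseteq> idx_set n" "dist (sum ?k P) (infsum ?k (idx_set n)) \<le> e\<^sup>2 / 2"
    using infsum_finite_approximation[OF sm, of "e\<^sup>2 / 2"] e by auto
  obtain J where J: "P \<subseteq> set (mode_list n J)"
    using finite_subset_mode_list[OF P(1,2)] order_refl by blast
  define F where "F = set (mode_list n J)"
  have F: "finite F" "F \<subseteq> idx_set n"
    by (auto simp: F_def set_mode_list idx_set_def)
  define g where "g x = (if x \<in> F then f x else 0)" for x
  have "g \<in> lspan (HJ_basis n J)"
    unfolding HJ_basis_eq lspan_unit[OF distinct_mode_list] by (simp add: g_def F_def)
  moreover have "l2_norm (\<lambda>x. f x - g x) < e"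
  proof -
    have "(\<Sum>\<^sub>\<infinity>x. (cmod (f x - g x))\<^sup>2) = infsum ?k (idx_set n - F)"
      by (rule infsum_cong_neutral) (use f in \<open>auto simp: g_def l2_space_def\<close>)
    also have "\<dots> = infsum ?k (idx_set n) - sum ?k F"
      using sm F by (subst infsum_Diff) auto
    also have "\<dots> \<le> infsum ?k (idx_set n) - sum ?k P"
      using J F by (intro diff_left_mono sum_mono2) (auto simp: F_def)
    also have "\<dots> \<le> e\<^sup>2 / 2"
      using P(3) unfolding dist_real_def by linarith
    also have "\<dots> < e\<^sup>2"
      using e by simp
    finally show ?thesis
      unfolding l2_norm_def using e by (intro real_less_lsqrt) (auto intro: infsum_nonneg)
  qed
  ultimately show "\<exists>N. \<exists>g\<in>lspan (HJ_basis n N). l2_norm (\<lambda>x. f x - g x) < e"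
    by blast
qed

section \<open>Fourier coefficients\<close>

text \<open>The conjugate of mode \<open>l\<close>, without the normalisation by
  \<open>X\<close>.\<close>

definition fourier_exp :: "real \<Rightarrow> int \<Rightarrow> real \<Rightarrow> complex" where
  "fourier_exp X l x = exp (- (2 * of_real pi * \<i> * of_int l * of_real x / of_real X))"

lemma fourier_coeff_eq:
  "fourier_coeff X f l = 1 / complex_of_real X * integral {0..X} (\<lambda>x. f x * fourier_exp X l x)"
  by (simp add: fourier_coeff_def fourier_exp_def)

lemma norm_fourier_exp [simp]: "cmod (fourier_exp X l x) = 1"
  by (simp add: fourier_exp_def)

lemma fourier_exp_mult_cnj: "fourier_exp X l x * cnj (fourier_exp X m x) = fourier_exp X (l - m) x"
  unfolding fourier_exp_def exp_cnj exp_add[symmetric]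
  by (rule arg_cong[of _ _ exp]) (simp add: algebra_simps diff_divide_distrib)

lemma continuous_on_fourier_exp: "continuous_on A (fourier_exp X l)"
  unfolding fourier_exp_def[abs_def] divide_inverse by (intro continuous_intros)

lemma has_integral_fourier_exp:
  assumes "X > 0"
  shows "(fourier_exp X l has_integral (if l = 0 then of_real X else 0)) {0..X}"
proof (cases "l = 0")
  case True
  then show ?thesis
    using has_integral_const_real[of "1::complex" 0 X] assms
    by (simp add: fourier_exp_def[abs_def] scaleR_conv_of_real)
next
  case False
  define a where "a = - (2 * of_real pi * \<i> * of_int l / of_real X)"
  have a: "a \<noteq> 0"
    using False assms by (simp add: a_def)
  have e: "fourier_exp X l x = exp (a * of_real x)" for x
    by (simp add: fourier_exp_def a_def mult_ac)
  have "((\<lambda>x. exp (a * of_real x)) has_integral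
      (exp (a * of_real X) / a - exp (a * of_real 0) / a)) {0..X}"
  proof (rule fundamental_theorem_of_calculus)
    fix x assume "x \<in> {0..X}"
    have "((\<lambda>z. exp (a * z) / a) has_field_derivative exp (a * of_real x)) (at (of_real x))"
      using a by (auto intro!: derivative_eq_intros)
    then show "((\<lambda>x. exp (a * of_real x) / a) has_vector_derivative exp (a * of_real x)) (at x within {0..X})"
      using has_vector_derivative_real_field has_vector_derivative_at_within by blast
  qed (use assms in simp)
  moreover have "exp (a * of_real X) = 1"
    unfolding exp_eq_1 using assms by (auto simp: a_def intro!: exI[of _ "- l"])
  ultimately show ?thesis
    using False by (simp add: e[abs_def])
qed

lemma L2_perD:
  assumes "L2_per X f"
  shows "f \<in> borel_measurable (lebesgue_on {0..X})"
    and "integrable (lebesgue_on {0..X}) (\<lambda>x. (cmod (f x))\<^sup>2)"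
proof -
  show "f \<in> borel_measurable (lebesgue_on {0..X})"
    using assms by (auto simp: L2_per_def intro: measurable_restrict_space1)
  have "(\<lambda>x. (cmod (f x))\<^sup>2) absolutely_integrable_on {0..X}"
    using assms by (intro nonnegative_absolutely_integrable_1) (auto simp: L2_per_def)
  then show "integrable (lebesgue_on {0..X}) (\<lambda>x. (cmod (f x))\<^sup>2)"
    by (rule absolutely_integrable_imp_integrable) simp
qed

lemma integrable_const_interval: "integrable (lebesgue_on {a..b::real}) (\<lambda>_. c :: real)"
  by (intro absolutely_integrable_imp_integrable absolutely_integrable_continuous_real
      continuous_on_const) simp

lemma fourier_exp_measurable:
  "fourier_exp X l \<in> borel_measurable (lebesgue_on {0..X})"
  "(\<lambda>x. cnj (fourier_exp X l x)) \<in> borel_measurable (lebesgue_on {0..X})"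
  by (intro continuous_imp_measurable_on_sets_lebesgue continuous_on_fourier_exp continuous_on_cnj; simp)+

lemma L2_per_mult_fourier_exp:
  assumes f: "L2_per X f"
  shows "integrable (lebesgue_on {0..X}) (\<lambda>x. f x * fourier_exp X l x)"
    and "(\<lambda>x. f x * fourier_exp X l x) integrable_on {0..X}"
proof -
  have "integrable (lebesgue_on {0..X}) (\<lambda>x. f x * cnj (cnj (fourier_exp X l x)))"
    using L2_perD[OF f] fourier_exp_measurable
    by (intro sq_integrable_mult_cnj) (auto simp: integrable_const_interval)
  then show *: "integrable (lebesgue_on {0..X}) (\<lambda>x. f x * fourier_exp X l x)"
    by simp
  show "(\<lambda>x. f x * fourier_exp X l x) integrable_on {0..X}"
    using * by (rule integrable_on_lebesgue_on) simp
qed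

text \<open>The entries of \<open>A1\<close> and \<open>A0\<close> are of this form; orthogonality
  of the modes sends the constant to mode zero alone.\<close>

lemma fourier_coeff_affine:
  assumes X: "X > 0" and f: "L2_per X f" and g: "L2_per X g"
  shows "fourier_coeff X (\<lambda>x. f x + b * g x + c) l
    = fourier_coeff X f l + b * fourier_coeff X g l + (if l = 0 then c else 0)"
proof -
  have "((\<lambda>x. f x * fourier_exp X l x + b * (g x * fourier_exp X l x) + c * fourier_exp X l x) has_integral
      integral {0..X} (\<lambda>x. f x * fourier_exp X l x) + b * integral {0..X} (\<lambda>x. g x * fourier_exp X l x)
      + c * (if l = 0 then of_real X else 0)) {0..X}"
    by (intro has_integral_add has_integral_mult_right has_integral_fourier_exp[OF X]
        integrable_integral L2_per_mult_fourier_exp f g)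
  then have "integral {0..X} (\<lambda>x. (f x + b * g x + c) * fourier_exp X l x)
     = integral {0..X} (\<lambda>x. f x * fourier_exp X l x) + b * integral {0..X} (\<lambda>x. g x * fourier_exp X l x)
      + c * (if l = 0 then of_real X else 0)"
    by (intro integral_unique) (simp add: algebra_simps)
  then show ?thesis
    unfolding fourier_coeff_eq using X by (simp add: field_simps)
qed

lemma summable_fourier_coeff:
  assumes X: "X > 0" and f: "L2_per X f"
  shows "(\<lambda>l. (cmod (fourier_coeff X f l))\<^sup>2) summable_on UNIV"
proof (rule nonneg_bounded_partial_sums_imp_summable_on)
  let ?M = "lebesgue_on {0..X}"
  \<comment> \<open>The orthonormal mode \<open>X^(-1/2) e^(2 pi i l x / X)\<close>. The coefficient
    of \<open>f\<close> along it is \<open>sqrt X * fourier_coeff X f l\<close>, which explains the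
    factor \<open>X\<close> below.\<close>
  define b where "b l x = cnj (fourier_exp X l x) / of_real (sqrt X)" for l x
  have int: "(LINT x|?M. fourier_exp X l x) = (if l = 0 then of_real X else 0)" for l
  proof -
    have "fourier_exp X l absolutely_integrable_on {0..X}"
      by (intro absolutely_integrable_continuous_real continuous_on_fourier_exp)
    then have "integrable ?M (fourier_exp X l)"
      by (rule absolutely_integrable_imp_integrable) simp
    then show ?thesis
      using lebesgue_integral_eq_integral[of "{0..X}" "fourier_exp X l"]
        integral_unique[OF has_integral_fourier_exp[OF X], of l] by simp
  qed
  have "(\<Sum>l\<in>L. (cmod (fourier_coeff X f l))\<^sup>2) \<le> (LINT x|?M. (cmod (f x))\<^sup>2) / X" if L: "finite L" for L
  proof -
    have "(\<Sum>l\<in>L. (cmod (LINT x|?M. f x * cnj (b l x)))\<^sup>2) \<le> (LINT x|?M. (cmod (f x))\<^sup>2)"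
    proof (rule bessel_inequality[OF L L2_perD[OF f]])
      fix l m
      show "b l \<in> borel_measurable ?M"
        unfolding b_def[abs_def] using fourier_exp_measurable by (intro borel_measurable_divide) auto
      show "integrable ?M (\<lambda>x. (cmod (b l x))\<^sup>2)"
        using X by (simp add: b_def norm_divide power_divide integrable_const_interval)
      have "b l x * cnj (b m x) = fourier_exp X (m - l) x / of_real X" for x
      proof -
        have "b l x * cnj (b m x) = (fourier_exp X m x * cnj (fourier_exp X l x)) / of_real (sqrt X * sqrt X)"
          unfolding of_real_mult by (simp add: b_def)
        then show ?thesis
          using X by (simp add: fourier_exp_mult_cnj del: of_real_mult)
      qed
      then show "(LINT x|?M. b l x * cnj (b m x)) = (if l = m then 1 else 0)"
        using X int[of "m - l"] by simp
    qed
    also have "(\<Sum>l\<in>L. (cmod (LINT x|?M. f x * cnj (b l x)))\<^sup>2)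
        = (\<Sum>l\<in>L. X * (cmod (fourier_coeff X f l))\<^sup>2)"
    proof (rule sum.cong[OF refl])
      fix l
      have "(LINT x|?M. f x * cnj (b l x)) = (LINT x|?M. f x * fourier_exp X l x) / of_real (sqrt X)"
        by (simp add: b_def)
      also have "(LINT x|?M. f x * fourier_exp X l x) = of_real X * fourier_coeff X f l"
        unfolding fourier_coeff_eq
        using lebesgue_integral_eq_integral[OF L2_per_mult_fourier_exp(1)[OF f]] X by simp
      finally have "cmod (LINT x|?M. f x * cnj (b l x)) = X * cmod (fourier_coeff X f l) / sqrt X"
        using X by (simp add: norm_mult norm_divide)
      then show "(cmod (LINT x|?M. f x * cnj (b l x)))\<^sup>2 = X * (cmod (fourier_coeff X f l))\<^sup>2"
        using X by (simp add: power_divide power_mult_distrib power2_eq_square)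
    qed
    finally show ?thesis
      using X by (simp add: sum_distrib_left[symmetric] field_simps)
  qed
  then show "eventually (\<lambda>L. (\<Sum>l\<in>L. (cmod (fourier_coeff X f l))\<^sup>2) \<le> (LINT x|?M. (cmod (f x))\<^sup>2) / X)
      (finite_subsets_at_top UNIV)"
    by (simp add: eventually_finite_subsets_at_top) blast
qed auto

section \<open>Decay of the Fourier multipliers\<close>

lemma summable_inverse_one_plus_freq_squared:
  assumes X: "X > 0"
  shows "(\<lambda>k. 1 / (1 + (freq X k)\<^sup>2)) summable_on UNIV"
proof -
  let ?g = "\<lambda>k. 1 / (1 + (freq X k)\<^sup>2)"
  \<comment> \<open>At \<open>n = 0\<close> the right-hand side is \<open>0\<close>, since
    \<open>inverse 0 = 0\<close>; hence the comparison below is only an eventual one.\<close>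
  have g_nat: "?g (int n) \<le> (X / (2 * pi))\<^sup>2 * inverse (real n ^ 2)" if "n > 0" for n
  proof -
    have "?g (int n) \<le> 1 / (freq X (int n))\<^sup>2"
      using that X by (intro frac_le) (auto simp: freq_def)
    also have "\<dots> = (X / (2 * pi))\<^sup>2 * inverse (real n ^ 2)"
      by (simp add: freq_def field_simps)
    finally show ?thesis .
  qed
  have "summable (\<lambda>n. ?g (int n))"
  proof (rule summable_comparison_test_ev)
    show "eventually (\<lambda>n. norm (?g (int n)) \<le> (X / (2 * pi))\<^sup>2 * inverse (real n ^ 2)) sequentially"
      using eventually_gt_at_top[of 0] by eventually_elim (use g_nat in simp)
    show "summable (\<lambda>n. (X / (2 * pi))\<^sup>2 * inverse (real n ^ 2))"
      by (intro summable_mult inverse_power_summable) simp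
  qed
  then have nat: "(\<lambda>n. ?g (int n)) summable_on UNIV"
    by (intro summable_nonneg_imp_summable_on) auto
  have "?g summable_on range int"
    using nat by (subst summable_on_reindex) (auto simp: comp_def)
  moreover have "?g summable_on range (\<lambda>n. - int n)"
    using nat by (subst summable_on_reindex) (auto simp: comp_def freq_def inj_def)
  ultimately have "?g summable_on range int \<union> range (\<lambda>n. - int n)"
    by (rule summable_on_union)
  moreover have "k \<in> range int \<union> range (\<lambda>n. - int n)" for k
    by (cases k rule: int_cases2) auto
  then have "range int \<union> range (\<lambda>n. - int n) = UNIV"
    by blast
  ultimately show ?thesis by simp
qed

text \<open>With \<open>w\<close> the squared frequency, the squared moduli are
  \<open>1 / (1 + w)\<^sup>2\<close> and \<open>w / (1 + w)\<^sup>2\<close>. The second decays only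
  like \<open>1 / w\<close>, which dictates the common weight \<open>1 / (1 + w)\<close>, still
  summable over the modes.\<close>

lemma cmod_symbols_squared:
  "(cmod (res_symbol X k))\<^sup>2 \<le> 1 / (1 + (freq X k)\<^sup>2)"
  "(cmod (dres_symbol X k))\<^sup>2 \<le> 1 / (1 + (freq X k)\<^sup>2)"
proof -
  define w where "w = (freq X k)\<^sup>2"
  have w: "w \<ge> 0" by (simp add: w_def)
  have ab: "\<bar>- (1 + w)\<bar> = 1 + w"
    using w by simp
  have den: "- ((complex_of_real (freq X k))\<^sup>2) - 1 = of_real (- (1 + w))"
    by (simp add: w_def)
  have "(cmod (res_symbol X k))\<^sup>2 = 1 / (1 + w)\<^sup>2"
    unfolding res_symbol_def den norm_divide norm_of_real ab by (simp add: power_divide)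
  also have "\<dots> \<le> 1 / (1 + w)"
    using w by (intro divide_left_mono) (auto simp: power2_eq_square)
  finally show "(cmod (res_symbol X k))\<^sup>2 \<le> 1 / (1 + (freq X k)\<^sup>2)"
    by (simp add: w_def)
  have "(cmod (dres_symbol X k))\<^sup>2 = w / (1 + w)\<^sup>2"
    unfolding dres_symbol_def den norm_divide norm_mult norm_of_real ab
    by (simp add: power_divide flip: w_def)
  also have "\<dots> \<le> (1 + w) / (1 + w)\<^sup>2"
    using w by (intro divide_right_mono) auto
  also have "\<dots> = 1 / (1 + w)"
    using w by (simp add: power2_eq_square)
  finally show "(cmod (dres_symbol X k))\<^sup>2 \<le> 1 / (1 + (freq X k)\<^sup>2)"
    by (simp add: w_def)
qed

section \<open>Uniform domination of the kernel\<close>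

text \<open>Summing over all component pairs yields one weight for every matrix entry; the
  \<open>1\<close> at \<open>l = 0\<close> accounts for the scalar terms
  \<open>2 i \<sigma>\<close>, \<open>- \<sigma>^2\<close> and \<open>1 - lam\<close> on the
  diagonal.\<close>

definition coeff_weight ::
  "nat \<Rightarrow> real \<Rightarrow> (nat \<Rightarrow> nat \<Rightarrow> real \<Rightarrow> complex) \<Rightarrow> (nat \<Rightarrow> nat \<Rightarrow> real \<Rightarrow> complex) \<Rightarrow> int \<Rightarrow> real" where
  "coeff_weight n X a0 a1 l =
     (\<Sum>i<n. \<Sum>j<n. (cmod (fourier_coeff X (a0 i j) l))\<^sup>2 + (cmod (fourier_coeff X (a1 i j) l))\<^sup>2)
     + (if l = 0 then 1 else 0)"

definition kernel_weight ::
  "nat \<Rightarrow> real \<Rightarrow> (nat \<Rightarrow> nat \<Rightarrow> real \<Rightarrow> complex) \<Rightarrow> (nat \<Rightarrow> nat \<Rightarrow> real \<Rightarrow> complex)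
    \<Rightarrow> (int \<times> nat) \<times> (int \<times> nat) \<Rightarrow> real" where
  "kernel_weight n X a0 a1 p =
     1 / (1 + (freq X (fst (fst p)))\<^sup>2) * coeff_weight n X a0 a1 (fst (fst p) - fst (snd p))"

lemma summable_on_finite_sum:
  fixes f :: "'b \<Rightarrow> 'a \<Rightarrow> 'c::topological_comm_monoid_add"
  assumes "finite I" "\<And>i. i \<in> I \<Longrightarrow> f i summable_on A"
  shows "(\<lambda>x. \<Sum>i\<in>I. f i x) summable_on A"
  using assms by (induction I rule: finite_induct) (auto intro: summable_on_add)

lemma coeff_weight_nonneg: "coeff_weight n X a0 a1 l \<ge> 0"
  unfolding coeff_weight_def by (intro add_nonneg_nonneg sum_nonneg) auto

lemma summable_coeff_weight:
  assumes X: "X > 0" and a: "\<forall>i<n. \<forall>j<n. L2_per X (a0 i j) \<and> L2_per X (a1 i j)"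
  shows "coeff_weight n X a0 a1 summable_on UNIV"
proof -
  have "(\<lambda>l::int. if l = 0 then 1 else 0 :: real) summable_on UNIV"
    by (rule finite_nonzero_values_imp_summable_on) (auto intro: finite_subset[of _ "{0}"])
  then show ?thesis
    unfolding coeff_weight_def[abs_def] using a
    by (intro summable_on_add summable_on_finite_sum summable_fourier_coeff[OF X]) auto
qed

text \<open>Shearing \<open>(k, m)\<close> to \<open>(k, k - m)\<close> turns the weight into a
  product of two summable functions, with the finitely many component pairs as a further factor.
  \<open>\<psi>\<close> performs the shear and \<open>\<phi>\<close> undoes it.\<close>

lemma summable_kernel_weight:
  assumes X: "X > 0" and a: "\<forall>i<n. \<forall>j<n. L2_per X (a0 i j) \<and> L2_per X (a1 i j)"
  shows "kernel_weight n X a0 a1 summable_on idx_set n \<times> idx_set n"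
proof -
  define g where "g k = 1 / (1 + (freq X k)\<^sup>2)" for k
  define \<phi> :: "(int \<times> int) \<times> (nat \<times> nat) \<Rightarrow> (int \<times> nat) \<times> (int \<times> nat)"
    where "\<phi> p = ((fst (fst p), fst (snd p)), (fst (fst p) - snd (fst p), snd (snd p)))" for p
  define \<psi> :: "(int \<times> nat) \<times> (int \<times> nat) \<Rightarrow> (int \<times> int) \<times> (nat \<times> nat)"
    where "\<psi> p = ((fst (fst p), fst (fst p) - fst (snd p)), (snd (fst p), snd (snd p)))" for p
  let ?A = "(UNIV \<times> UNIV) \<times> ({..<n} \<times> {..<n})"
  have g: "g summable_on UNIV" "g k \<ge> 0" for k
    using summable_inverse_one_plus_freq_squared[OF X] by (simp_all add: g_def[abs_def])
  have "(\<lambda>(k, l). g k * coeff_weight n X a0 a1 l) summable_on UNIV \<times> UNIV"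
    by (intro summable_on_times_nonneg g summable_coeff_weight[OF X a] coeff_weight_nonneg)
  then have "(\<lambda>(u, v). (case u of (k, l) \<Rightarrow> g k * coeff_weight n X a0 a1 l) * (\<lambda>_. 1) v) summable_on ?A"
    by (rule summable_on_times_nonneg) (auto simp: g(2) coeff_weight_nonneg)
  then have "(\<lambda>p. kernel_weight n X a0 a1 (\<phi> p)) summable_on ?A"
    by (simp add: kernel_weight_def \<phi>_def g_def case_prod_unfold)
  moreover have "bij_betw \<phi> ?A (idx_set n \<times> idx_set n)"
    by (rule bij_betw_byWitness[where f' = \<psi>]) (auto simp: \<phi>_def \<psi>_def idx_set_def)
  ultimately show ?thesis
    using summable_on_reindex_bij_betw by blast
qed

lemma sum3_squared_le: "(x + y + z)\<^sup>2 \<le> 3 * (x\<^sup>2 + y\<^sup>2 + z\<^sup>2)" for x y z :: real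
proof -
  have "3 * (x\<^sup>2 + y\<^sup>2 + z\<^sup>2) - (x + y + z)\<^sup>2 = (x - y)\<^sup>2 + (y - z)\<^sup>2 + (x - z)\<^sup>2"
    by (simp add: power2_eq_square algebra_simps)
  then show ?thesis
    using zero_le_power2[of "x - y"] zero_le_power2[of "y - z"] zero_le_power2[of "x - z"] by linarith
qed

text \<open>The factor \<open>3\<close> comes from \<open>sum3_squared_le\<close>; the squares are
  those of the coefficients of the \<open>a1\<close>, \<open>a0\<close> and diagonal parts of a
  kernel entry.\<close>

definition kernel_bound :: "real \<Rightarrow> real" where
  "kernel_bound \<Lambda> = 3 * ((1 + 2 * pi)\<^sup>2 + 1 + (4 * pi + (2 * pi)\<^sup>2 + 1 + \<Lambda>)\<^sup>2)"

text \<open>An entry is a combination of the Fourier coefficients \<open>\<alpha>0\<close>,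
  \<open>\<alpha>1\<close> and the diagonal indicator \<open>\<delta>\<close>, with both multipliers
  at most \<open>sqrt g\<close>. The ranges of \<open>\<sigma>\<close> and \<open>lam\<close> bound
  the combination, leaving a weight free of both parameters.\<close>

lemma cmod_K_kernel_squared_le:
  assumes X: "X > 0" and a: "\<forall>i<n. \<forall>j<n. L2_per X (a0 i j) \<and> L2_per X (a1 i j)"
    and \<sigma>: "0 \<le> \<sigma>" "\<sigma> < 2 * pi" and \<Lambda>: "cmod lam \<le> \<Lambda>"
    and pq: "p \<in> idx_set n" "q \<in> idx_set n"
  shows "(cmod (K_kernel n X a0 a1 \<sigma> lam p q))\<^sup>2 \<le> kernel_bound \<Lambda> * kernel_weight n X a0 a1 (p, q)"
proof -
  obtain k i m j where p: "p = (k, i)" "i < n" and q: "q = (m, j)" "j < n"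
    using pq by (auto simp: idx_set_def)
  define \<delta> :: real where "\<delta> = (if p = q then 1 else 0)"
  define \<alpha>0 where "\<alpha>0 = fourier_coeff X (a0 i j) (k - m)"
  define \<alpha>1 where "\<alpha>1 = fourier_coeff X (a1 i j) (k - m)"
  define g where "g = 1 / (1 + (freq X k)\<^sup>2)"
  have L2: "L2_per X (a0 i j)" "L2_per X (a1 i j)"
    using a p q by auto
  have \<Lambda>0: "\<Lambda> \<ge> 0"
    using \<Lambda> norm_ge_zero order.trans by blast
  \<comment> \<open>Idempotence lets the squared diagonal term match the indicator inside
    \<open>coeff_weight\<close>.\<close>
  have \<delta>: "\<delta> \<ge> 0" "\<delta>\<^sup>2 = \<delta>"
    by (simp_all add: \<delta>_def)
  have fA1: "fourier_coeff X (A1 a1 \<sigma> i j) (k - m) = \<alpha>1 + 2 * \<i> * of_real \<sigma> * of_real \<delta>"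
    using fourier_coeff_affine[OF X L2(2) L2(2), of 0 "if i = j then 2 * \<i> * of_real \<sigma> else 0" "k - m"]
    by (simp add: A1_def[abs_def] \<alpha>1_def \<delta>_def p q)
  have fA0: "fourier_coeff X (A0 a0 a1 \<sigma> i j) (k - m)
      = \<alpha>0 + \<i> * of_real \<sigma> * \<alpha>1 - of_real (\<sigma>\<^sup>2) * of_real \<delta>"
  proof -
    have "A0 a0 a1 \<sigma> i j = (\<lambda>x. a0 i j x + \<i> * of_real \<sigma> * a1 i j x + (if i = j then - of_real (\<sigma>\<^sup>2) else 0))"
      by (auto simp: A0_def fun_eq_iff)
    then show ?thesis
      using fourier_coeff_affine[OF X L2, of "\<i> * of_real \<sigma>" "if i = j then - of_real (\<sigma>\<^sup>2) else 0" "k - m"]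
      by (simp add: \<alpha>0_def \<alpha>1_def \<delta>_def p q)
  qed
  have K: "K_kernel n X a0 a1 \<sigma> lam p q = dres_symbol X k * (\<alpha>1 + 2 * \<i> * of_real \<sigma> * of_real \<delta>)
      + res_symbol X k * (\<alpha>0 + \<i> * of_real \<sigma> * \<alpha>1 - of_real (\<sigma>\<^sup>2) * of_real \<delta> + (1 - lam) * of_real \<delta>)"
    unfolding K_kernel_def mult_kernel_def id_kernel_def using p q by (simp add: fA1 fA0 \<delta>_def)
  \<comment> \<open>\<open>?c1\<close> collects \<open>a1\<close> from \<open>A1\<close> and
    \<open>i \<sigma> a1\<close> from \<open>A0\<close>; \<open>?c2\<close> collects
    \<open>2 i \<sigma>\<close>, \<open>\<sigma>^2\<close> and \<open>1 - lam\<close>, estimated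
    with \<open>\<sigma> < 2 * pi\<close> and \<open>cmod lam \<le> \<Lambda>\<close>.\<close>
  let ?c1 = "1 + 2 * pi" and ?c2 = "4 * pi + (2 * pi)\<^sup>2 + 1 + \<Lambda>"
  have s: "cmod (dres_symbol X k) \<le> sqrt g" "cmod (res_symbol X k) \<le> sqrt g"
    using cmod_symbols_squared[of X k] by (simp_all add: g_def real_le_rsqrt)
  have b1: "cmod (\<alpha>1 + 2 * \<i> * of_real \<sigma> * of_real \<delta>) \<le> cmod \<alpha>1 + 4 * pi * \<delta>"
  proof -
    have "cmod (2 * \<i> * of_real \<sigma> * of_real \<delta>) \<le> 4 * pi * \<delta>"
      using \<sigma> \<delta>(1) mult_right_mono[of \<sigma> "2 * pi" \<delta>] by (simp add: norm_mult mult_ac)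
    then show ?thesis by (intro norm_triangle_mono order_refl)
  qed
  have b0: "cmod (\<alpha>0 + \<i> * of_real \<sigma> * \<alpha>1 - of_real (\<sigma>\<^sup>2) * of_real \<delta> + (1 - lam) * of_real \<delta>)
      \<le> cmod \<alpha>0 + 2 * pi * cmod \<alpha>1 + (2 * pi)\<^sup>2 * \<delta> + (1 + \<Lambda>) * \<delta>"
  proof -
    have 1: "cmod (\<i> * of_real \<sigma> * \<alpha>1) \<le> 2 * pi * cmod \<alpha>1"
      using \<sigma> by (auto simp: norm_mult intro!: mult_right_mono)
    have 2: "cmod (of_real (\<sigma>\<^sup>2) * of_real \<delta>) \<le> (2 * pi)\<^sup>2 * \<delta>"
    proof -
      have "\<sigma>\<^sup>2 \<le> (2 * pi)\<^sup>2"
        using \<sigma> by (intro power_mono) auto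
      then have "\<sigma>\<^sup>2 * \<delta> \<le> (2 * pi)\<^sup>2 * \<delta>"
        using \<delta>(1) by (rule mult_right_mono)
      then show ?thesis
        using \<delta>(1) unfolding norm_mult norm_of_real by simp
    qed
    have "cmod (1 - lam) \<le> 1 + \<Lambda>"
      using norm_triangle_ineq4[of 1 lam] \<Lambda> by simp
    then have 3: "cmod ((1 - lam) * of_real \<delta>) \<le> (1 + \<Lambda>) * \<delta>"
      using \<delta>(1) by (auto simp: norm_mult intro!: mult_right_mono)
    show ?thesis
      using norm_triangle_ineq[of \<alpha>0 "\<i> * of_real \<sigma> * \<alpha>1"]
        norm_triangle_ineq4[of "\<alpha>0 + \<i> * of_real \<sigma> * \<alpha>1" "of_real (\<sigma>\<^sup>2) * of_real \<delta>"]
        norm_triangle_ineq[of "\<alpha>0 + \<i> * of_real \<sigma> * \<alpha>1 - of_real (\<sigma>\<^sup>2) * of_real \<delta>" "(1 - lam) * of_real \<delta>"]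
        1 2 3 by linarith
  qed
  have "cmod (K_kernel n X a0 a1 \<sigma> lam p q) \<le> sqrt g * (cmod \<alpha>1 + 4 * pi * \<delta>)
      + sqrt g * (cmod \<alpha>0 + 2 * pi * cmod \<alpha>1 + (2 * pi)\<^sup>2 * \<delta> + (1 + \<Lambda>) * \<delta>)"
    unfolding K using \<delta>(1) \<Lambda>0 s b0 b1
    by (intro norm_triangle_mono) (auto simp only: norm_mult intro!: mult_mono, auto simp: g_def)
  also have "\<dots> = sqrt g * (?c1 * cmod \<alpha>1 + cmod \<alpha>0 + ?c2 * \<delta>)"
    by (simp add: algebra_simps)
  finally have "(cmod (K_kernel n X a0 a1 \<sigma> lam p q))\<^sup>2 \<le> (sqrt g * (?c1 * cmod \<alpha>1 + cmod \<alpha>0 + ?c2 * \<delta>))\<^sup>2"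
    by (intro power_mono) auto
  also have "\<dots> = g * (?c1 * cmod \<alpha>1 + cmod \<alpha>0 + ?c2 * \<delta>)\<^sup>2"
    by (simp add: power_mult_distrib g_def)
  also have "\<dots> \<le> g * (kernel_bound \<Lambda> * ((cmod \<alpha>0)\<^sup>2 + (cmod \<alpha>1)\<^sup>2 + \<delta>))"
  proof (intro mult_left_mono)
    have "(?c1 * cmod \<alpha>1 + cmod \<alpha>0 + ?c2 * \<delta>)\<^sup>2 \<le> 3 * ((?c1 * cmod \<alpha>1)\<^sup>2 + (cmod \<alpha>0)\<^sup>2 + (?c2 * \<delta>)\<^sup>2)"
      by (rule sum3_squared_le)
    also have "\<dots> = 3 * (?c1\<^sup>2 * (cmod \<alpha>1)\<^sup>2 + 1 * (cmod \<alpha>0)\<^sup>2 + ?c2\<^sup>2 * \<delta>)"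
      unfolding power_mult_distrib \<delta>(2) by simp
    \<comment> \<open>Each coefficient is enlarged to the sum of all three, so that a single factor
      can be pulled out.\<close>
    also have "\<dots> \<le> 3 * ((?c1\<^sup>2 + 1 + ?c2\<^sup>2) * (cmod \<alpha>1)\<^sup>2 + (?c1\<^sup>2 + 1 + ?c2\<^sup>2) * (cmod \<alpha>0)\<^sup>2
        + (?c1\<^sup>2 + 1 + ?c2\<^sup>2) * \<delta>)"
      using \<delta>(1) by (intro mult_left_mono add_mono mult_right_mono) auto
    also have "\<dots> = kernel_bound \<Lambda> * ((cmod \<alpha>0)\<^sup>2 + (cmod \<alpha>1)\<^sup>2 + \<delta>)"
      unfolding kernel_bound_def by (simp only: distrib_left distrib_right mult.assoc)
    finally show "(?c1 * cmod \<alpha>1 + cmod \<alpha>0 + ?c2 * \<delta>)\<^sup>2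
        \<le> kernel_bound \<Lambda> * ((cmod \<alpha>0)\<^sup>2 + (cmod \<alpha>1)\<^sup>2 + \<delta>)" .
  qed (simp add: g_def)
  also have "\<dots> \<le> g * (kernel_bound \<Lambda> * coeff_weight n X a0 a1 (k - m))"
  proof (intro mult_left_mono)
    let ?h = "\<lambda>i j. (cmod (fourier_coeff X (a0 i j) (k - m)))\<^sup>2 + (cmod (fourier_coeff X (a1 i j) (k - m)))\<^sup>2"
    have "?h i j \<le> (\<Sum>j<n. ?h i j)"
      using q by (intro member_le_sum) auto
    also have "\<dots> \<le> (\<Sum>i<n. \<Sum>j<n. ?h i j)"
      using p by (intro member_le_sum[of i "{..<n}" "\<lambda>i. \<Sum>j<n. ?h i j"])
        (auto intro!: sum_nonneg add_nonneg_nonneg)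
    finally have "?h i j \<le> (\<Sum>i<n. \<Sum>j<n. ?h i j)" .
    \<comment> \<open>Only an inequality: equal modes may still carry different components.\<close>
    moreover have "\<delta> \<le> (if k - m = 0 then 1 else 0)"
      by (simp add: \<delta>_def p q)
    ultimately show "(cmod \<alpha>0)\<^sup>2 + (cmod \<alpha>1)\<^sup>2 + \<delta> \<le> coeff_weight n X a0 a1 (k - m)"
      unfolding coeff_weight_def \<alpha>0_def \<alpha>1_def by (rule add_mono)
  qed (simp_all add: g_def kernel_bound_def)
  also have "\<dots> = kernel_bound \<Lambda> * kernel_weight n X a0 a1 (p, q)"
    by (simp add: kernel_weight_def g_def p q)
  finally show ?thesis .
qed

section \<open>Uniform convergence of the truncated determinants\<close>

lemma kernel_bound_pos: "kernel_bound \<Lambda> > 0"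
  unfolding kernel_bound_def by (rule mult_pos_pos[OF _ add_pos_nonneg[OF add_nonneg_pos]]) simp_all

lemma hilbert_schmidt_K_kernel:
  assumes X: "X > 0" and a: "\<forall>i<n. \<forall>j<n. L2_per X (a0 i j) \<and> L2_per X (a1 i j)"
    and \<sigma>: "0 \<le> \<sigma>" "\<sigma> < 2 * pi"
  shows "hilbert_schmidt (idx_set n) (\<lambda>p q. - K_kernel n X a0 a1 \<sigma> lam p q)"
  unfolding hilbert_schmidt_def
proof
  show "\<forall>x y. (x, y) \<notin> idx_set n \<times> idx_set n \<longrightarrow> - K_kernel n X a0 a1 \<sigma> lam x y = 0"
    by (auto simp: idx_set_def K_kernel_def mult_kernel_def id_kernel_def)
  have "(\<lambda>p. kernel_bound (cmod lam) * kernel_weight n X a0 a1 p) summable_on idx_set n \<times> idx_set n"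
    by (intro summable_on_cmult_right summable_kernel_weight[OF X a])
  then show "(\<lambda>(x, y). (cmod (- K_kernel n X a0 a1 \<sigma> lam x y))\<^sup>2) summable_on idx_set n \<times> idx_set n"
    by (rule summable_on_comparison_test) (auto intro: cmod_K_kernel_squared_le[OF X a \<sigma>])
qed

text \<open>The radius \<open>R\<close>, the tolerance \<open>d\<close> and the finite set
  \<open>P\<close> are drawn from the weight \<open>W\<close> before \<open>\<sigma>\<close> and
  \<open>lam\<close> are fixed; hence \<open>J0\<close> is uniform in both.\<close>

lemma det2_fin_modes_uniformly_close:
  assumes X: "X > 0" and a: "\<forall>i<n. \<forall>j<n. L2_per X (a0 i j) \<and> L2_per X (a1 i j)" and e: "e > 0"
  shows "\<exists>J0. \<forall>J\<ge>J0. \<forall>\<sigma>\<in>{0..<2 * pi}. \<forall>lam. cmod lam \<le> \<Lambda> \<longrightarrow>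
       cmod (D_sigma_J n X a0 a1 \<sigma> lam J - D_sigma n X a0 a1 \<sigma> lam) < e"
proof -
  let ?S = "idx_set n"
  define W where "W p = kernel_bound \<Lambda> * kernel_weight n X a0 a1 p" for p
  have W: "W summable_on ?S \<times> ?S"
    unfolding W_def[abs_def] by (intro summable_on_cmult_right summable_kernel_weight[OF X a])
  have W0: "W p \<ge> 0" for p
    unfolding W_def kernel_weight_def using kernel_bound_pos[of \<Lambda>] coeff_weight_nonneg
    by (intro mult_nonneg_nonneg) auto
  define R where "R = sqrt (infsum W (?S \<times> ?S))"
  have R: "infsum W (?S \<times> ?S) = R\<^sup>2" "R \<ge> 0"
    by (simp_all add: R_def infsum_nonneg W0)
  \<comment> \<open>Makes the estimate of \<open>det2_I_minus_close\<close> equal to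
    \<open>e / 2\<close>, strictly below \<open>e\<close>.\<close>
  define d where "d = e / 2 / exp ((R + 1)\<^sup>2 / 2)"
  have d: "d > 0" "exp ((R + 1)\<^sup>2 / 2) * d = e / 2"
    using e by (simp_all add: d_def)
  obtain P where P: "finite P" "P \<subseteq> ?S \<times> ?S" "dist (sum W P) (infsum W (?S \<times> ?S)) \<le> d\<^sup>2"
    using infsum_finite_approximation[OF W, of "d\<^sup>2"] d by auto
  have "finite (fst ` P \<union> snd ` P)" "fst ` P \<union> snd ` P \<subseteq> ?S"
    using P(1,2) by auto
  then obtain J0 where J0: "\<And>J. J \<ge> J0 \<Longrightarrow> fst ` P \<union> snd ` P \<subseteq> set (mode_list n J)"
    using finite_subset_mode_list by meson
  have "cmod (D_sigma_J n X a0 a1 \<sigma> lam J - D_sigma n X a0 a1 \<sigma> lam) < e"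
    if J: "J \<ge> J0" and \<sigma>: "0 \<le> \<sigma>" "\<sigma> < 2 * pi" and lam: "cmod lam \<le> \<Lambda>" for J \<sigma> lam
  proof -
    define K where "K p q = - K_kernel n X a0 a1 \<sigma> lam p q" for p q
    let ?F = "set (mode_list n J)"
    have K: "hilbert_schmidt ?S K"
      unfolding K_def[abs_def] by (rule hilbert_schmidt_K_kernel[OF X a \<sigma>])
    have le: "(cmod (K (fst p) (snd p)))\<^sup>2 \<le> W p" if "p \<in> ?S \<times> ?S" for p
      using that cmod_K_kernel_squared_le[OF X a \<sigma> lam, of "fst p" "snd p"]
      by (auto simp: K_def W_def)
    have F: "finite ?F" "?F \<subseteq> ?S" "P \<subseteq> ?F \<times> ?F"
      using J0[OF J] by (auto simp: set_mode_list idx_set_def)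
    have tail: "hs_sq (kernel_tail ?F K) \<le> d\<^sup>2"
      using kernel_tail_le[OF K W le F] P(3) unfolding dist_real_def by linarith
    \<comment> \<open>The tail of the empty truncation is the whole kernel, so the tail estimate
      also bounds \<open>hs_sq K\<close> by the total weight.\<close>
    have "hs_sq (kernel_tail {} K) \<le> R\<^sup>2"
      using kernel_tail_le[OF K W le, of "{}" "{}"] R(1) by simp
    then have "hs_sq K \<le> R\<^sup>2"
      by (simp add: kernel_tail_def[abs_def] restrict_kernel_def)
    then have "cmod (det2_fin (kernel_mat K (mode_list n J)) - det2_I_minus ?S K) \<le> e / 2"
      using det2_I_minus_close[OF K admissible_HJ_basis distinct_mode_list F(2) _ R(2) tail d(1)] d(2)
      by simp
    then show ?thesis
      using e unfolding D_sigma_J_def D_sigma_def HJ_basis_eq compression_unit K_def[abs_def] by simp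
  qed
  then show ?thesis
    by (intro exI[of _ J0]) auto
qed

theorem theorem3p8:
  fixes X :: real and n :: nat and a0 a1 :: "nat \<Rightarrow> nat \<Rightarrow> real \<Rightarrow> complex"
  assumes "X > 0" and "n \<ge> 1"
    and "\<forall>i<n. \<forall>j<n. L2_per X (a0 i j) \<and> L2_per X (a1 i j)"
  shows "\<forall>C::complex set. compact C \<longrightarrow>
    (\<forall>e>0. \<exists>J0. \<forall>J\<ge>J0. \<forall>\<sigma>\<in>{0..<2*pi}. \<forall>lam\<in>C.
       cmod (D_sigma_J n X a0 a1 \<sigma> lam J - D_sigma n X a0 a1 \<sigma> lam) < e)"
proof (intro allI impI)
  fix C :: "complex set" and e :: real
  assume "compact C" "e > 0"
  \<comment> \<open>The kernel estimates are uniform on a disc of radius \<open>\<Lambda>\<close>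
    containing \<open>C\<close>.\<close>
  then obtain \<Lambda> where \<Lambda>: "\<And>lam. lam \<in> C \<Longrightarrow> cmod lam \<le> \<Lambda>"
    using compact_imp_bounded bounded_iff by metis
  show "\<exists>J0. \<forall>J\<ge>J0. \<forall>\<sigma>\<in>{0..<2*pi}. \<forall>lam\<in>C.
      cmod (D_sigma_J n X a0 a1 \<sigma> lam J - D_sigma n X a0 a1 \<sigma> lam) < e"
    using det2_fin_modes_uniformly_close[OF assms(1,3) \<open>e > 0\<close>, of \<Lambda>] \<Lambda> by meson
qed

end
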